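(* Let $X=N+A$ be of class $(\Sigma)$ with only negative jumps and $A_\infty=\infty$ almost surely, and let $\varphi:\mathbb{R}_+\to\mathbb{R}_+$ be a nonnegative locally bounded Borel function such that $\int_0^\infty\varphi(x)\,dx=\infty$. Define the stopping time $$T=\inf\{t:\ \varphi(A_t)X_t=1\}.$$ Then $T<\infty$ a.s. and, for all $x\ge0$, $$\mathbb{P}(A_T>x)=\exp\left(-\int_0^x\varphi(z)\,dz\right).$$
   Context: All processes are defined on a filtered probability space satisfying the usual conditions; "increasing" means nondecreasing. A nonnegative local submartingale $X$ with decomposition $X_t=N_t+A_t$ is of class $(\Sigma)$ if: (i) $(N_t)$ is a càdlàg local martingale with $N_0=0$; (ii) $(A_t)$ is a continuous adapted increasing process with $A_0=0$; (iii) the measure $(dA_t)$ is carried by the set $\{t: X_t=0\}$. "Only negative jumps" means $X_t-X_{t-}\le 0$ for all $t>0$ (continuous $X$ is allowed). $A_\infty=\lim_{t\to\infty}A_t$. *)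

theory Defs
  imports "HOL-Probability.Probability"
begin

text \<open>
  Processes are functions \<open>X t \<omega>\<close> of a real time \<open>t\<close>, only the values at \<open>t \<ge> 0\<close> being meaningful.
  Filtrations and stopping times are the library ones with index type \<^typ>\<open>ennreal\<close>, so that stopping
  times take values in \<open>[0, \<infinity>]\<close>. The additional \<open>\<sigma>\<close>-algebra \<open>F \<infinity>\<close> is any one between all the \<open>F t\<close>
  and \<open>M\<close>; it imposes no restriction, since \<open>{T \<le> \<infinity>}\<close> is the whole space.
  Path properties are required almost surely; null sets belong to \<open>F 0\<close>.
\<close>

locale usual_filtered_prob_space =
  prob_space M + complete_measure M + filtration "space M" F
  for M :: "'a measure" and F :: "ennreal \<Rightarrow> 'a measure" +
  assumes subalgebra_F: "\<And>t. subalgebra M (F t)"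
    and null_sets_F: "null_sets M \<subseteq> sets (F 0)"
    and right_continuous_F: "\<And>t. t < \<infinity> \<Longrightarrow> sets (F t) = (\<Inter>s\<in>{t<..}. sets (F s))"

definition adapted :: "(ennreal \<Rightarrow> 'a measure) \<Rightarrow> (real \<Rightarrow> 'a \<Rightarrow> real) \<Rightarrow> bool" where
  "adapted F X \<longleftrightarrow> (\<forall>t\<ge>0. X t \<in> borel_measurable (F (ennreal t)))"

definition cadlag_path :: "(real \<Rightarrow> real) \<Rightarrow> bool" where
  "cadlag_path f \<longleftrightarrow>
     (\<forall>t\<ge>0. (f \<longlongrightarrow> f t) (at_right t)) \<and> (\<forall>t>0. \<exists>l. (f \<longlongrightarrow> l) (at_left t))"

definition martingale ::
    "'a measure \<Rightarrow> (ennreal \<Rightarrow> 'a measure) \<Rightarrow> (real \<Rightarrow> 'a \<Rightarrow> real) \<Rightarrow> bool" where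
  "martingale M F X \<longleftrightarrow> adapted F X \<and> (\<forall>t\<ge>0. integrable M (X t)) \<and>
     (\<forall>s\<ge>0. \<forall>t\<ge>s. AE \<omega> in M. real_cond_exp M (F (ennreal s)) (X t) \<omega> = X s \<omega>)"

definition submartingale ::
    "'a measure \<Rightarrow> (ennreal \<Rightarrow> 'a measure) \<Rightarrow> (real \<Rightarrow> 'a \<Rightarrow> real) \<Rightarrow> bool" where
  "submartingale M F X \<longleftrightarrow> adapted F X \<and> (\<forall>t\<ge>0. integrable M (X t)) \<and>
     (\<forall>s\<ge>0. \<forall>t\<ge>s. AE \<omega> in M. X s \<omega> \<le> real_cond_exp M (F (ennreal s)) (X t) \<omega>)"

definition value_at :: "(real \<Rightarrow> 'a \<Rightarrow> real) \<Rightarrow> ('a \<Rightarrow> ennreal) \<Rightarrow> 'a \<Rightarrow> real" where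
  "value_at X T \<omega> = X (enn2real (T \<omega>)) \<omega>"

definition stopped :: "(real \<Rightarrow> 'a \<Rightarrow> real) \<Rightarrow> ('a \<Rightarrow> ennreal) \<Rightarrow> real \<Rightarrow> 'a \<Rightarrow> real" where
  "stopped X T t = value_at X (\<lambda>\<omega>. min (ennreal t) (T \<omega>))"

definition localizing ::
    "'a measure \<Rightarrow> (ennreal \<Rightarrow> 'a measure) \<Rightarrow> (nat \<Rightarrow> 'a \<Rightarrow> ennreal) \<Rightarrow> bool" where
  "localizing M F \<tau> \<longleftrightarrow> (\<forall>n. stopping_time F (\<tau> n)) \<and>
     (AE \<omega> in M. incseq (\<lambda>n. \<tau> n \<omega>) \<and> (\<lambda>n. \<tau> n \<omega>) \<longlonglongrightarrow> \<infinity>)"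

text \<open>
  The initial value is subtracted before localizing; for processes started at \<open>0\<close>, such as those
  of class \<open>(\<Sigma>)\<close>, the usual conventions about the initial value agree.
\<close>

definition local_martingale ::
    "'a measure \<Rightarrow> (ennreal \<Rightarrow> 'a measure) \<Rightarrow> (real \<Rightarrow> 'a \<Rightarrow> real) \<Rightarrow> bool" where
  "local_martingale M F X \<longleftrightarrow> adapted F X \<and> (AE \<omega> in M. cadlag_path (\<lambda>t. X t \<omega>)) \<and>
     (\<exists>\<tau>. localizing M F \<tau> \<and> (\<forall>n. martingale M F (\<lambda>t \<omega>. stopped X (\<tau> n) t \<omega> - X 0 \<omega>)))"

definition local_submartingale ::
    "'a measure \<Rightarrow> (ennreal \<Rightarrow> 'a measure) \<Rightarrow> (real \<Rightarrow> 'a \<Rightarrow> real) \<Rightarrow> bool" where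
  "local_submartingale M F X \<longleftrightarrow> adapted F X \<and> (AE \<omega> in M. cadlag_path (\<lambda>t. X t \<omega>)) \<and>
     (\<exists>\<tau>. localizing M F \<tau> \<and> (\<forall>n. submartingale M F (\<lambda>t \<omega>. stopped X (\<tau> n) t \<omega> - X 0 \<omega>)))"

text \<open>
  In the last clause, \<open>dA\<close> is the Lebesgue-Stieltjes measure of the path of \<open>A\<close>, extended to
  negative times by the constant \<open>A 0\<close>; it does not charge \<open>(-\<infinity>, 0]\<close>.
\<close>

definition class_Sigma :: "'a measure \<Rightarrow> (ennreal \<Rightarrow> 'a measure) \<Rightarrow>
    (real \<Rightarrow> 'a \<Rightarrow> real) \<Rightarrow> (real \<Rightarrow> 'a \<Rightarrow> real) \<Rightarrow> (real \<Rightarrow> 'a \<Rightarrow> real) \<Rightarrow> bool" where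
  "class_Sigma M F X N A \<longleftrightarrow>
     local_submartingale M F X \<and>
     (AE \<omega> in M. \<forall>t\<ge>0. 0 \<le> X t \<omega>) \<and>
     (AE \<omega> in M. \<forall>t\<ge>0. X t \<omega> = N t \<omega> + A t \<omega>) \<and>
     local_martingale M F N \<and> (AE \<omega> in M. N 0 \<omega> = 0) \<and>
     adapted F A \<and>
     (AE \<omega> in M. continuous_on {0..} (\<lambda>t. A t \<omega>) \<and> mono_on {0..} (\<lambda>t. A t \<omega>) \<and> A 0 \<omega> = 0) \<and>
     (AE \<omega> in M. AE t in interval_measure (\<lambda>t. A (max 0 t) \<omega>). 0 \<le> t \<longrightarrow> X t \<omega> = 0)"

definition only_negative_jumps :: "'a measure \<Rightarrow> (real \<Rightarrow> 'a \<Rightarrow> real) \<Rightarrow> bool" where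
  "only_negative_jumps M X \<longleftrightarrow>
     (AE \<omega> in M. \<forall>t>0. X t \<omega> - Lim (at_left t) (\<lambda>s. X s \<omega>) \<le> 0)"

definition locally_bounded_on :: "real set \<Rightarrow> (real \<Rightarrow> real) \<Rightarrow> bool" where
  "locally_bounded_on S f \<longleftrightarrow> (\<forall>K. compact K \<and> K \<subseteq> S \<longrightarrow> bounded (f ` K))"

text \<open>The infimum of the empty set is \<open>\<infinity>\<close>.\<close>

definition hitting_time ::
    "(real \<Rightarrow> real) \<Rightarrow> (real \<Rightarrow> 'a \<Rightarrow> real) \<Rightarrow> (real \<Rightarrow> 'a \<Rightarrow> real) \<Rightarrow> 'a \<Rightarrow> ennreal" where
  "hitting_time \<phi> A X \<omega> = Inf {ennreal t | t. 0 \<le> t \<and> \<phi> (A t \<omega>) * X t \<omega> = 1}"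

end

theory Submission
  imports Defs "HOL-Real_Asymp.Real_Asymp"
begin

text \<open>
  Since \<open>X\<close> has no positive jumps, its zero set is closed and \<open>A\<close> is locally constant where
  \<open>X > 0\<close>. For \<open>\<tau>\<^sub>b = inf {t. A t > b}\<close> this gives \<open>X (v \<and> \<tau>\<^sub>b) = X v * 1{A v \<le> b}\<close> and
  \<open>A (v \<and> \<tau>\<^sub>b) = min (A v) b\<close>, so optional stopping of \<open>N = X - A\<close> at \<open>v \<and> \<tau>\<^sub>b\<close> yields
  \<open>E (X v * 1{A v \<le> b}) = E (min (A v) b)\<close> for bounded stopping times \<open>v\<close> that localize \<open>N\<close>. By uniqueness
  of measures \<open>E (X v * g (A v)) = E (G (A v))\<close> for all Borel \<open>g \<ge> 0\<close> with primitive \<open>G\<close>. With \<open>\<Phi>\<close> the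
  primitive of \<open>\<phi>\<close>, the choice \<open>g = exp \<Phi> * \<phi> * 1{\<le> x}\<close> makes both sides bounded up to \<open>T\<close>, and the
  limit \<open>v \<rightarrow> T\<close> determines \<open>P (A T > x)\<close>.

  A priori \<open>X\<close> could approach the level \<open>1 / \<phi> (A)\<close> from the left and jump down from it. Therefore
  the limit \<open>S\<close> of the passage times at levels \<open>1 - 1/(n+2)\<close> of \<open>\<phi> (A) * X\<close> replaces \<open>T\<close>. It is
  plainly a stopping time, and comparing the identity at \<open>S\<close> with its limit along the passage times shows
  that almost surely there is no jump at \<open>S\<close>, hence \<open>S = T\<close>.
\<close>

section \<open>Paths\<close>

text \<open>The weight in \<open>g\<close> solves a differential equation. Where
  \<open>\<phi> (A) * X\<close> is 1, the left side of the identity is the mean of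
  \<open>(g / \<phi>) (A)\<close> and the right side that of \<open>G (A)\<close>. Asking for
  \<open>g / \<phi> = G + 1\<close> with \<open>G 0 = 0\<close> means
  \<open>G' = \<phi> * (G + 1)\<close>, hence \<open>G = exp \<Phi> - 1\<close>. With the cutoff at
  \<open>x\<close>, the unknown contributions of \<open>A T \<le> x\<close> cancel, and
  \<open>exp (\<Phi> x) * P (A T > x) = 1\<close> is left. The event \<open>T = \<infinity>\<close>
  fits into the same computation: there \<open>A\<close> outgrows \<open>x\<close>, so the cutoff
  empties the left side, and the right side is \<open>exp (\<Phi> x) - 1\<close>, exactly as on
  \<open>A T > x\<close>. The formula thus gives at first the probability that
  \<open>T = \<infinity>\<close> or \<open>A T > x\<close>; letting \<open>\<Phi> x\<close> tend to
  infinity then shows that \<open>T\<close> is finite. Passage times are infima over rational times,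
  so that they are stopping times by countable set operations. The price is a pathwise argument that
  the remaining times behave no differently.\<close>

definition entrance_time :: "(real \<Rightarrow> bool) \<Rightarrow> ennreal" where
  "entrance_time P = (INF q\<in>{q \<in> \<rat>. 0 \<le> q \<and> P q}. ennreal q)"

lemma entrance_time_less_iff:
  "entrance_time P < ennreal t \<longleftrightarrow> (\<exists>q\<in>\<rat>. 0 \<le> q \<and> q < t \<and> P q)"
  unfolding entrance_time_def INF_less_iff by (auto simp: ennreal_less_iff)

text \<open>A single deterministic path, so that the path arguments are free of null sets; they are
  later interpreted at almost every outcome. Existence of left limits and absence of positive jumps
  are joined in \<open>x_left\<close>.\<close>

locale sigma_path =
  fixes x a :: "real \<Rightarrow> real"
  assumes x_nonneg: "\<And>t. 0 \<le> t \<Longrightarrow> 0 \<le> x t"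
    and x_right: "\<And>t. 0 \<le> t \<Longrightarrow> (x \<longlongrightarrow> x t) (at_right t)"
    and x_left: "\<And>t. 0 < t \<Longrightarrow> \<exists>l. (x \<longlongrightarrow> l) (at_left t) \<and> x t \<le> l"
    and x_0: "x 0 = 0"
    and a_continuous: "continuous_on {0..} a"
    and a_mono: "mono_on {0..} a"
    and a_0: "a 0 = 0"
    and carried: "AE t in interval_measure (\<lambda>t. a (max 0 t)). 0 \<le> t \<longrightarrow> x t = 0"
begin

lemma a_le: "0 \<le> s \<Longrightarrow> s \<le> t \<Longrightarrow> a s \<le> a t"
  using a_mono by (auto simp: mono_on_def)

lemma a_nonneg: "0 \<le> t \<Longrightarrow> 0 \<le> a t"
  using a_le[of 0 t] a_0 by simp

lemma isCont_a: "isCont (\<lambda>t. a (max 0 t)) t"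
proof -
  have "continuous_on UNIV (a \<circ> max 0)"
    by (intro continuous_on_compose continuous_intros continuous_on_subset[OF a_continuous]) auto
  then show ?thesis
    by (auto simp: o_def continuous_on_eq_continuous_at)
qed

lemma a_tendsto:
  assumes "0 \<le> t" "(f \<longlongrightarrow> t) G" "eventually (\<lambda>s. 0 \<le> f s) G"
  shows "((\<lambda>s. a (f s)) \<longlongrightarrow> a t) G"
proof -
  have "((\<lambda>s. a (max 0 (f s))) \<longlongrightarrow> a (max 0 t)) G"
    using isCont_tendsto_compose[OF isCont_a assms(2)] .
  then show ?thesis
    using assms(1,3) by (auto elim!: Lim_transform_eventually eventually_mono simp: max_def)
qed

lemma a_left: "0 < t \<Longrightarrow> (a \<longlongrightarrow> a t) (at_left t)"
  using eventually_at_left_real[of 0 t]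
  by (intro a_tendsto[where f = "\<lambda>s. s"]) (auto elim: eventually_mono)

lemma a_right: "0 \<le> t \<Longrightarrow> (a \<longlongrightarrow> a t) (at_right t)"
  using eventually_at_right_less[of t]
  by (intro a_tendsto[where f = "\<lambda>s. s"]) (auto elim: eventually_mono)

text \<open>The interval lies in the set where \<open>x\<close> does not vanish, which is null for
  the Stieltjes measure, and its mass is the increment of \<open>a\<close>.\<close>

lemma a_constant_Ioc:
  assumes "0 \<le> u" "u \<le> v" and pos: "\<And>s. u < s \<Longrightarrow> s \<le> v \<Longrightarrow> 0 < x s"
  shows "a v = a u"
proof -
  let ?\<mu> = "interval_measure (\<lambda>t. a (max 0 t))"
  obtain N where N: "{t \<in> space ?\<mu>. \<not> (0 \<le> t \<longrightarrow> x t = 0)} \<subseteq> N" "emeasure ?\<mu> N = 0" "N \<in> sets ?\<mu>"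
    using carried by (rule AE_E)
  have "{u<..v} \<subseteq> N"
    using N(1) pos assms(1) by (fastforce simp: space_interval_measure)
  then have "emeasure ?\<mu> {u<..v} = 0"
    using N(2,3) by (metis emeasure_mono le_zero_eq)
  moreover have "emeasure ?\<mu> {u<..v} = ennreal (a (max 0 v) - a (max 0 u))"
  proof (rule emeasure_interval_measure_Ioc[OF assms(2)])
    show "continuous (at_right t) (\<lambda>t. a (max 0 t))" for t
      using isCont_a continuous_at_imp_continuous_at_within by blast
  qed (auto intro!: a_le)
  ultimately have "ennreal (a v - a u) = 0"
    using assms(1,2) by simp
  then have "a v \<le> a u"
    by (simp add: ennreal_eq_0_iff)
  then show ?thesis
    using a_le[OF assms(1,2)] by simp
qed

text \<open>Positivity is asked of the left limit, not of \<open>x t\<close>: the path may jump down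
  to 0 at \<open>t\<close>, and still \<open>a\<close> is constant just before \<open>t\<close>.
  Continuity of \<open>a\<close> carries this constant over to \<open>t\<close> itself.\<close>

lemma x_pos_left:
  assumes "0 < t" "(x \<longlongrightarrow> l) (at_left t)" "0 < l"
  obtains e where "0 < e" "e < t" "\<And>s. t - e < s \<Longrightarrow> s < t \<Longrightarrow> 0 < x s \<and> a s = a t"
proof -
  have "eventually (\<lambda>s. 0 < x s) (at_left t)"
    using assms(2,3) by (rule order_tendstoD)
  then obtain b where b: "b < t" "\<And>s. b < s \<Longrightarrow> s < t \<Longrightarrow> 0 < x s"
    unfolding eventually_at_left_field by auto
  \<comment> \<open>The bound \<open>t/2\<close> keeps the interval inside positive times, where the
    Stieltjes argument applies.\<close>
  define c where "c = max b (t/2)"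
  have c: "b \<le> c" "0 < c" "c < t"
    using b(1) assms(1) by (auto simp: c_def)
  have eq: "a s = a s'" if "c < s" "s \<le> s'" "s' < t" for s s'
    using a_constant_Ioc[of s s'] b(2) that c by force
  have "a s = a t" if s: "c < s" "s < t" for s
  proof -
    have "(a \<longlongrightarrow> a t) (at_left t)"
      using assms(1) by (rule a_left)
    moreover have "eventually (\<lambda>r. a r = a s) (at_left t)"
      unfolding eventually_at_left_field using s eq by (intro exI[of _ s]) (auto, metis less_imp_le)
    ultimately have "((\<lambda>r. a s) \<longlongrightarrow> a t) (at_left t)"
      by (rule Lim_transform_eventually)
    then show ?thesis
      by (simp add: tendsto_const_iff trivial_limit_at_left_real)
  qed
  then show ?thesis
    using b(2) c by (intro that[of "t - c"]) auto
qed

lemma x_pos_right: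
  assumes "0 \<le> t" "0 < x t"
  obtains e where "0 < e" "\<And>s. t \<le> s \<Longrightarrow> s < t + e \<Longrightarrow> 0 < x s \<and> a s = a t"
proof -
  have "eventually (\<lambda>s. 0 < x s) (at_right t)"
    using x_right[OF assms(1)] assms(2) by (rule order_tendstoD)
  then obtain b where b: "t < b" "\<And>s. t < s \<Longrightarrow> s < b \<Longrightarrow> 0 < x s"
    unfolding eventually_at_right_field by auto
  have "a s = a t" if "t \<le> s" "s < b" for s
    using a_constant_Ioc[of t s] b(2) that assms by force
  then show ?thesis
    using that[of "b - t"] b assms(2) by (metis add.commute diff_add_cancel diff_gt_0_iff_gt order_le_less)
qed

lemma x_pos_time: "0 \<le> t \<Longrightarrow> 0 < x t \<Longrightarrow> 0 < t"
  using x_0 by (cases "t = 0") auto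

text \<open>If \<open>\<tau>\<close> is finite, then \<open>a\<close> increases immediately after \<open>\<tau>\<close>, so \<open>x\<close> vanishes at \<open>\<tau>\<close>.\<close>

lemma entrance_level:
  fixes b v :: real
  assumes "0 \<le> b"
  defines "\<tau> \<equiv> entrance_time (\<lambda>q. b < a q)"
  assumes "0 \<le> v"
  shows "x (enn2real (min (ennreal v) \<tau>)) = (if a v \<le> b then x v else 0)"
    and "a (enn2real (min (ennreal v) \<tau>)) = min (a v) b"
proof -
  have before: "a t \<le> b" if "0 \<le> t" "ennreal t \<le> \<tau>" for t
  proof (rule ccontr)
    assume *: "\<not> a t \<le> b"
    then have "t \<noteq> 0" using a_0 assms(1) by auto
    then have "0 < t" using that by simp
    have "(a \<longlongrightarrow> a t) (at_left t)"
      using \<open>0 < t\<close> by (rule a_left)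
    then have "eventually (\<lambda>s. b < a s) (at_left t)"
      using * by (intro order_tendstoD) auto
    then obtain c where c: "c < t" "\<And>s. c < s \<Longrightarrow> s < t \<Longrightarrow> b < a s"
      unfolding eventually_at_left_field by auto
    obtain q where "q \<in> \<rat>" "max 0 c < q" "q < t"
      using Rats_dense_in_real[of "max 0 c" t] c(1) \<open>0 < t\<close> by auto
    then have "\<tau> < ennreal t"
      unfolding \<tau>_def entrance_time_less_iff using c(2) by (intro bexI[of _ q]) auto
    with that show False by simp
  qed
  have after: "b < a t" if t: "0 \<le> t" "\<tau> < ennreal t" for t
  proof -
    obtain q where q: "0 \<le> q" "q < t" "b < a q"
      using t unfolding \<tau>_def entrance_time_less_iff by auto
    with a_le[of q t] show ?thesis by simp
  qed
  show "x (enn2real (min (ennreal v) \<tau>)) = (if a v \<le> b then x v else 0)"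
    and "a (enn2real (min (ennreal v) \<tau>)) = min (a v) b"
  proof (atomize (full), cases "a v \<le> b")
    case True
    then have "\<not> \<tau> < ennreal v" using after[of v] assms(3) by auto
    then have "min (ennreal v) \<tau> = ennreal v" by (auto simp: min_def)
    with True assms(3) show "x (enn2real (min (ennreal v) \<tau>)) = (if a v \<le> b then x v else 0) \<and>
      a (enn2real (min (ennreal v) \<tau>)) = min (a v) b" by simp
  next
    case False
    then have less: "\<tau> < ennreal v" using before[of v] assms(3) by (meson not_le)
    then obtain r where r: "\<tau> = ennreal r" "0 \<le> r" "r < v"
      by (cases \<tau>) (auto simp: ennreal_less_iff)
    have ar: "a s > b" if "r < s" for s
      using after[of s] r that by (auto simp: ennreal_less_iff)
    have "a r \<le> b" using before[of r] r by simp
    moreover have "(a \<longlongrightarrow> a r) (at_right r)"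
      using r(2) by (rule a_right)
    then have "b \<le> a r"
      by (rule tendsto_lowerbound) (auto simp: eventually_at_right_field intro!: exI[of _ "r+1"] less_imp_le ar)
    ultimately have "a r = b" by simp
    moreover have "x r = 0"
    proof (rule ccontr)
      assume "x r \<noteq> 0"
      then have "0 < x r" using x_nonneg[OF r(2)] by simp
      then obtain e where e: "0 < e" "\<And>s. r \<le> s \<Longrightarrow> s < r + e \<Longrightarrow> a s = a r"
        using x_pos_right[OF r(2)] by metis
      then show False using ar[of "r + e/2"] e(1) e(2)[of "r + e/2"] \<open>a r = b\<close> by simp
    qed
    moreover have "min (ennreal v) \<tau> = ennreal r" using less r by (auto simp: min_def)
    ultimately show "x (enn2real (min (ennreal v) \<tau>)) = (if a v \<le> b then x v else 0) \<and>
      a (enn2real (min (ennreal v) \<tau>)) = min (a v) b" using False r(2) by simp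
  qed
qed

end

section \<open>Passage of the weighted path through levels below 1\<close>

definition first_passage :: "(real \<Rightarrow> real) \<Rightarrow> (real \<Rightarrow> real) \<Rightarrow> (real \<Rightarrow> real) \<Rightarrow> real \<Rightarrow> ennreal" where
  "first_passage \<phi> a x c = entrance_time (\<lambda>q. c < \<phi> (a q) * x q)"

text \<open>The offset 2 makes the lowest level \<open>1/2\<close>. Positive levels keep
  \<open>x\<close> away from 0 at the passages, and strict growth keeps the passage times
  apart.\<close>

definition level :: "nat \<Rightarrow> real" where
  "level n = 1 - 1 / (real n + 2)"

lemma level_pos: "0 < level n" and level_less_1: "level n < 1"
  by (auto simp: level_def field_simps)

lemma strict_mono_level: "strict_mono level"
  by (auto simp: strict_mono_def level_def field_simps)

lemma level_tendsto: "level \<longlonglongrightarrow> 1"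
  unfolding level_def by real_asymp

text \<open>The levels increase to \<open>1\<close>; the weighted path cannot jump upwards, so it takes each of them
  before it can take the value \<open>1\<close>.\<close>

definition announcing_limit :: "(real \<Rightarrow> real) \<Rightarrow> (real \<Rightarrow> real) \<Rightarrow> (real \<Rightarrow> real) \<Rightarrow> ennreal" where
  "announcing_limit \<phi> a x = (SUP n. first_passage \<phi> a x (level n))"

text \<open>The weight \<open>\<phi>\<close> may be discontinuous, yet \<open>f\<close> is
  tractable: where \<open>x\<close> is positive, \<open>a\<close> is locally constant and
  \<open>f\<close> is locally a constant multiple of \<open>x\<close>; near a zero of
  \<open>x\<close> at which \<open>x\<close> is continuous from the relevant side, the local bound
  on \<open>\<phi>\<close> makes \<open>f\<close> small.\<close>

locale weighted_sigma_path = sigma_path +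
  fixes \<phi> :: "real \<Rightarrow> real"
  assumes phi_nonneg: "\<And>y. 0 \<le> y \<Longrightarrow> 0 \<le> \<phi> y"
    and phi_bounded: "\<And>b. \<exists>K>0. \<forall>y\<in>{0..b}. \<phi> y \<le> K"
begin

abbreviation "f \<equiv> (\<lambda>t. \<phi> (a t) * x t)"

abbreviation "passage \<equiv> first_passage \<phi> a x"
abbreviation "announce \<equiv> announcing_limit \<phi> a x"

text \<open>A value above \<open>c\<close> at an arbitrary time persists to the right, because
  \<open>a\<close> is constant there and \<open>x\<close> is right-continuous. Some rational time
  before the passage would then also lie above \<open>c\<close>.\<close>

lemma f_le_before:
  assumes "0 < c" "0 \<le> s" "ennreal s < passage c"
  shows "f s \<le> c"
proof (rule ccontr)
  assume *: "\<not> f s \<le> c"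
  have "x s \<noteq> 0"
    using * assms(1) by auto
  then have "0 < x s"
    using x_nonneg[OF assms(2)] by simp
  then obtain e where e: "0 < e" "\<And>r. s \<le> r \<Longrightarrow> r < s + e \<Longrightarrow> 0 < x r \<and> a r = a s"
    using x_pos_right[OF assms(2)] by metis
  have "((\<lambda>r. \<phi> (a s) * x r) \<longlongrightarrow> f s) (at_right s)"
    by (intro tendsto_intros x_right assms)
  then have "eventually (\<lambda>r. c < \<phi> (a s) * x r) (at_right s)"
    using * by (intro order_tendstoD) auto
  then obtain b where b: "s < b" "\<And>r. s < r \<Longrightarrow> r < b \<Longrightarrow> c < \<phi> (a s) * x r"
    unfolding eventually_at_right_field by auto
  \<comment> \<open>The minimum is taken in \<open>ennreal\<close> because \<open>passage c\<close>
    may be infinite.\<close>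
  have "ennreal s < min (passage c) (min (ennreal b) (ennreal (s + e)))"
    using assms b(1) e(1) by (simp add: ennreal_less_iff)
  then obtain z where z: "ennreal s < z" "z < min (passage c) (min (ennreal b) (ennreal (s + e)))"
    using dense by blast
  obtain r where r: "z = ennreal r" "0 \<le> r"
    using z(2) by (cases z) auto
  have "s < r" "r < b" "r < s + e" "ennreal r < passage c"
    using z r assms(2) by (auto simp: ennreal_less_iff)
  obtain q where q: "q \<in> \<rat>" "s < q" "q < r"
    using Rats_dense_in_real[OF \<open>s < r\<close>] by auto
  have "c < f q"
    using b(2)[of q] e(2)[of q] q \<open>r < b\<close> \<open>r < s + e\<close> by simp
  then have "passage c < ennreal r"
    unfolding first_passage_def entrance_time_less_iff using q assms(2) by (intro bexI[of _ q]) auto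
  with \<open>ennreal r < passage c\<close> show False by simp
qed

text \<open>Times with values above \<open>c\<close> accumulate at \<open>r\<close> from the right
  or include \<open>r\<close>. This excludes \<open>x r = 0\<close>, since \<open>\<phi>\<close> is
  bounded near there, and so makes \<open>a\<close> constant on both sides of \<open>r\<close>. The
  lower bound then comes from right-continuity, the upper bound from the values before
  \<open>r\<close> and the absence of positive jumps.\<close>

lemma f_passage:
  assumes "0 < c" "passage c = ennreal r" "0 \<le> r"
  shows "f r = c"
proof -
  have ex: "\<exists>q. r \<le> q \<and> q < r + e \<and> c < f q" if "0 < e" for e
  proof -
    have "passage c < ennreal (r + e)"
      using that assms by (simp add: ennreal_less_iff)
    then obtain q where q: "0 \<le> q" "q < r + e" "c < f q" "q \<in> \<rat>"
      unfolding first_passage_def entrance_time_less_iff by auto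
    have "\<not> q < r"
      using f_le_before[of c q] assms q by (auto simp: ennreal_less_iff)
    with q show ?thesis by (meson not_less)
  qed
  \<comment> \<open>The bound covers the range of \<open>a\<close> up to \<open>r + 1\<close>; the
    witnesses \<open>q\<close> are chosen before that time, hence the \<open>min 1\<close>
    below.\<close>
  obtain K where K: "0 < K" "\<And>y. 0 \<le> y \<Longrightarrow> y \<le> a (r + 1) \<Longrightarrow> \<phi> y \<le> K"
    using phi_bounded[of "a (r+1)"] by auto
  have "0 < x r"
  proof (rule ccontr)
    assume "\<not> 0 < x r"
    then have "x r < c / K"
      using assms(1) K(1) by (smt (verit) divide_pos_pos)
    moreover have "eventually (\<lambda>s. x s < c / K) (at_right r)"
      using calculation by (rule order_tendstoD[OF x_right[OF assms(3)]])
    then obtain b where "r < b" "\<And>s. r < s \<Longrightarrow> s < b \<Longrightarrow> x s < c / K"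
      unfolding eventually_at_right_field by auto
    moreover obtain q where q: "r \<le> q" "q < r + min 1 (b - r)" "c < f q"
      using ex[of "min 1 (b - r)"] \<open>r < b\<close> by auto
    ultimately have "x q < c / K"
      by (cases "q = r") auto
    moreover have "f q \<le> K * x q"
      using q assms(3) by (intro mult_right_mono K x_nonneg a_nonneg a_le) auto
    ultimately show False
      using q(3) K(1) by (simp add: pos_less_divide_eq mult.commute)
  qed
  then have "0 < r"
    using x_pos_time assms(3) by simp
  obtain l where l: "(x \<longlongrightarrow> l) (at_left r)" "x r \<le> l"
    using x_left[OF \<open>0 < r\<close>] by auto
  obtain e where e: "0 < e" "e < r" "\<And>s. r - e < s \<Longrightarrow> s < r \<Longrightarrow> a s = a r"
    using x_pos_left[OF \<open>0 < r\<close> l(1)] l(2) \<open>0 < x r\<close> by (smt (verit))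
  have "\<phi> (a r) * l \<le> c"
  proof (rule tendsto_upperbound)
    show "((\<lambda>s. \<phi> (a r) * x s) \<longlongrightarrow> \<phi> (a r) * l) (at_left r)"
      by (intro tendsto_intros l)
    have "\<phi> (a r) * x s \<le> c" if "r - e < s" "s < r" for s
      using f_le_before[of c s] e that assms by (auto simp: ennreal_less_iff)
    then show "eventually (\<lambda>s. \<phi> (a r) * x s \<le> c) (at_left r)"
      unfolding eventually_at_left_field using e by (intro exI[of _ "r - e"]) auto
  qed (rule trivial_limit_at_left_real)
  moreover have "f r \<le> \<phi> (a r) * l"
    using l(2) assms(3) by (intro mult_left_mono phi_nonneg a_nonneg)
  moreover have "c \<le> f r"
  proof (rule ccontr)
    assume "\<not> c \<le> f r"
    moreover have "((\<lambda>s. \<phi> (a r) * x s) \<longlongrightarrow> f r) (at_right r)"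
      by (intro tendsto_intros x_right assms)
    ultimately have "eventually (\<lambda>s. \<phi> (a r) * x s < c) (at_right r)"
      by (intro order_tendstoD) auto
    then obtain b where b: "r < b" "\<And>s. r < s \<Longrightarrow> s < b \<Longrightarrow> \<phi> (a r) * x s < c"
      unfolding eventually_at_right_field by auto
    obtain e' where e': "0 < e'" "\<And>s. r \<le> s \<Longrightarrow> s < r + e' \<Longrightarrow> a s = a r"
      using x_pos_right[OF assms(3) \<open>0 < x r\<close>] by metis
    obtain q where q: "r \<le> q" "q < r + min e' (b - r)" "c < f q"
      using ex[of "min e' (b - r)"] b(1) e'(1) by auto
    show False
      using b(2)[of q] e'(2)[of q] q \<open>\<not> c \<le> f r\<close> by (cases "q = r") (auto simp: min_def split: if_splits)
  qed
  ultimately show ?thesis by simp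
qed

lemma passage_le:
  assumes "0 < c" "c < f t" "0 \<le> t"
  shows "passage c \<le> ennreal t"
  using f_le_before[of c t] assms by (meson not_le)

lemma passage_mono:
  assumes "c \<le> d"
  shows "passage c \<le> passage d"
  unfolding first_passage_def entrance_time_def using assms by (intro INF_superset_mono) auto

lemma passage_le_announce: "passage (level n) \<le> announce"
  unfolding announcing_limit_def by (rule SUP_upper) simp

lemma f_le_before_announce:
  assumes "0 \<le> s" "ennreal s < announce"
  shows "f s \<le> 1"
proof -
  obtain n where "ennreal s < passage (level n)"
    using assms(2) unfolding announcing_limit_def less_SUP_iff by auto
  then have "f s \<le> level n"
    by (intro f_le_before level_pos assms(1))
  with level_less_1[of n] show ?thesis by simp
qed

lemma announce_le:
  assumes "0 \<le> t" "f t = 1"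
  shows "announce \<le> ennreal t"
  unfolding announcing_limit_def
proof (rule SUP_least)
  show "passage (level n) \<le> ennreal t" for n
    by (rule passage_le) (simp_all only: level_pos level_less_1 assms)
qed

text \<open>The passage times increase strictly to \<open>r\<close>, so the values of
  \<open>x\<close> along them tend to the left limit \<open>l\<close>. They stay above a fixed
  positive number, so \<open>l\<close> is positive and \<open>a\<close> is constant just before
  \<open>r\<close>. The levels then give \<open>\<phi> (a r) * l = 1\<close>. Only an inequality
  survives at \<open>r\<close>, because \<open>x\<close> may still jump down there; this gap cannot
  be closed path by path.\<close>

lemma announce_finite:
  assumes "announce = ennreal r" "0 \<le> r"
  shows "eventually (\<lambda>n. a (enn2real (passage (level n))) = a r) sequentially" and "f r \<le> 1"
proof -
  define R where "R n = enn2real (passage (level n))" for n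
  have R: "passage (level n) = ennreal (R n)" for n
    using passage_le_announce[of n] assms unfolding R_def
    by (metis ennreal_enn2real ennreal_less_top le_less_trans)
  have R0: "0 \<le> R n" for n
    by (simp add: R_def)
  have fR: "f (R n) = level n" for n
    by (intro f_passage level_pos R R0)
  have incR: "incseq R"
    using passage_mono[OF strict_mono_mono[OF strict_mono_level, THEN monoD]] R0
    by (auto simp: incseq_def R ennreal_le_iff)
  \<comment> \<open>Passages at different levels show different values of \<open>f\<close> and so
    happen at different times. This puts every \<open>R n\<close> strictly before \<open>r\<close>,
    as convergence within \<open>at_left r\<close> requires.\<close>
  have strictR: "R n < R (Suc n)" for n
  proof -
    have "R n \<noteq> R (Suc n)"
      using fR[of n] fR[of "Suc n"] strict_mono_level strict_monoD[of level n "Suc n"] by auto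
    moreover have "R n \<le> R (Suc n)"
      using incR by (simp add: incseq_SucD)
    ultimately show ?thesis by simp
  qed
  have Rle: "R n \<le> r" for n
    using passage_le_announce[of n] assms R0 by (auto simp: R ennreal_le_iff)
  have Rless: "R n < r" for n
    using strictR[of n] Rle[of "Suc n"] by simp
  have Rlim: "R \<longlonglongrightarrow> r"
  proof -
    have "incseq (\<lambda>n. ennreal (R n))"
      using incR by (auto simp: incseq_def intro!: ennreal_leI)
    then have "(\<lambda>n. ennreal (R n)) \<longlonglongrightarrow> ennreal r"
      using LIMSEQ_SUP[of "\<lambda>n. ennreal (R n)"] assms unfolding announcing_limit_def R by simp
    then show ?thesis
      using tendsto_ennreal_iff[of R sequentially r] R0 assms(2) by simp
  qed
  then have Rleft: "filterlim R (at_left r) sequentially"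
    using Rless unfolding at_within_def by (intro filterlim_inf[THEN iffD2]) (auto simp: filterlim_principal)
  have "0 < r"
    using Rless[of 0] R0[of 0] by simp
  obtain l where l: "(x \<longlongrightarrow> l) (at_left r)" "x r \<le> l"
    using x_left[OF \<open>0 < r\<close>] by auto
  have xR: "(\<lambda>n. x (R n)) \<longlonglongrightarrow> l"
    using filterlim_compose[OF l(1) Rleft] .
  obtain K where K: "0 < K" "\<And>y. 0 \<le> y \<Longrightarrow> y \<le> a r \<Longrightarrow> \<phi> y \<le> K"
    using phi_bounded[of "a r"] by auto
  \<comment> \<open>All values of \<open>f\<close> along the passages are at least
    \<open>level 0\<close>, and the weight is at most \<open>K\<close> there.\<close>
  have "level 0 / K \<le> l"
  proof (rule tendsto_lowerbound[OF xR])
    have "level 0 \<le> K * x (R n)" for n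
    proof -
      have "level 0 \<le> level n"
        using strict_mono_mono[OF strict_mono_level] by (simp add: monoD)
      also have "\<dots> = f (R n)" by (simp add: fR)
      also have "\<dots> \<le> K * x (R n)"
        using Rle R0 by (intro mult_right_mono K x_nonneg a_nonneg a_le) auto
      finally show ?thesis .
    qed
    then show "\<forall>\<^sub>F n in sequentially. level 0 / K \<le> x (R n)"
      using K(1) by (simp add: pos_divide_le_eq mult.commute)
  qed simp
  then have "0 < l"
    using K(1) level_pos[of 0] by (smt (verit) divide_pos_pos)
  obtain e where e: "0 < e" "\<And>s. r - e < s \<Longrightarrow> s < r \<Longrightarrow> a s = a r"
    using x_pos_left[OF \<open>0 < r\<close> l(1) \<open>0 < l\<close>] by metis
  have "eventually (\<lambda>n. r - e < R n) sequentially"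
    using e(1) by (intro order_tendstoD[OF Rlim]) auto
  then show ev: "eventually (\<lambda>n. a (enn2real (passage (level n))) = a r) sequentially"
    unfolding R_def[symmetric] by eventually_elim (use e(2) Rless in auto)
  have "(\<lambda>n. \<phi> (a r) * x (R n)) \<longlonglongrightarrow> \<phi> (a r) * l"
    by (intro tendsto_intros xR)
  moreover have "eventually (\<lambda>n. \<phi> (a r) * x (R n) = level n) sequentially"
    using ev unfolding R_def[symmetric] by eventually_elim (metis fR)
  ultimately have "level \<longlonglongrightarrow> \<phi> (a r) * l"
    by (rule Lim_transform_eventually)
  then have "\<phi> (a r) * l = 1"
    using level_tendsto LIMSEQ_unique by blast
  moreover have "f r \<le> \<phi> (a r) * l"
    using l(2) assms(2) by (intro mult_left_mono phi_nonneg a_nonneg)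
  ultimately show "f r \<le> 1" by simp
qed

end

section \<open>Stopping times and optional stopping\<close>

text \<open>Paths are regular only almost surely, so limits identify stopped values only outside a
  null set. Completeness makes the identified functions measurable.\<close>

lemma (in complete_measure) borel_measurable_AE_cong:
  assumes f: "f \<in> borel_measurable M" and eq: "AE x in M. f x = g x"
  shows "g \<in> borel_measurable M"
proof (rule measurableI)
  fix B :: "'b set" assume "B \<in> sets borel"
  with f have "f -` B \<inter> space M \<in> sets M"
    by (rule measurable_sets)
  moreover have "AE x in M. x \<in> f -` B \<inter> space M \<longleftrightarrow> x \<in> g -` B \<inter> space M"
    using eq by eventually_elim auto
  ultimately show "g -` B \<inter> space M \<in> sets M"
    by (intro in_sets_AE[of "f -` B \<inter> space M" "g -` B \<inter> space M"]) auto
qed simp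

text \<open>Vitali's theorem, with uniform integrability stated through the excess over
  \<open>R\<close> instead of a tail integral. The excess is continuous in the value, so Fatou's
  lemma transfers its bound to the limit, and it is exactly the error of clamping to the interval
  from \<open>-R\<close> to \<open>R\<close>. The clamped functions converge by dominated
  convergence.\<close>

lemma (in finite_measure) integral_tendsto_uniformly_integrable:
  fixes V :: "nat \<Rightarrow> 'a \<Rightarrow> real"
  assumes int: "\<And>m. integrable M (V m)"
    and lim: "AE \<omega> in M. (\<lambda>m. V m \<omega>) \<longlonglongrightarrow> W \<omega>"
    and W[measurable]: "W \<in> borel_measurable M"
    and ui: "\<And>e. 0 < e \<Longrightarrow> \<exists>R\<ge>0. \<forall>m. (\<integral>\<omega>. max (\<bar>V m \<omega>\<bar> - R) 0 \<partial>M) \<le> e"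
  shows "integrable M W" and "(\<lambda>m. \<integral>\<omega>. V m \<omega> \<partial>M) \<longlonglongrightarrow> (\<integral>\<omega>. W \<omega> \<partial>M)"
proof -
  have [measurable]: "V m \<in> borel_measurable M" for m
    using int by auto
  have tail_int: "integrable M (\<lambda>\<omega>. max (\<bar>V m \<omega>\<bar> - R) 0)" for m R
    using int by (intro integrable_max integrable_diff integrable_abs) auto
  have fatou: "(\<integral>\<^sup>+\<omega>. ennreal (max (\<bar>W \<omega>\<bar> - R) 0) \<partial>M) \<le> ennreal e"
    if R: "\<And>m. (\<integral>\<omega>. max (\<bar>V m \<omega>\<bar> - R) 0 \<partial>M) \<le> e" for R e
  proof -
    have "AE \<omega> in M. ennreal (max (\<bar>W \<omega>\<bar> - R) 0) = liminf (\<lambda>m. ennreal (max (\<bar>V m \<omega>\<bar> - R) 0))"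
      using lim
    proof eventually_elim
      case (elim \<omega>)
      then have "(\<lambda>m. ennreal (max (\<bar>V m \<omega>\<bar> - R) 0)) \<longlonglongrightarrow> ennreal (max (\<bar>W \<omega>\<bar> - R) 0)"
        by (intro tendsto_ennrealI tendsto_max tendsto_diff tendsto_rabs tendsto_const)
      then show ?case
        by (simp add: lim_imp_Liminf)
    qed
    then have "(\<integral>\<^sup>+\<omega>. ennreal (max (\<bar>W \<omega>\<bar> - R) 0) \<partial>M)
        = (\<integral>\<^sup>+\<omega>. liminf (\<lambda>m. ennreal (max (\<bar>V m \<omega>\<bar> - R) 0)) \<partial>M)"
      by (rule nn_integral_cong_AE)
    also have "\<dots> \<le> liminf (\<lambda>m. \<integral>\<^sup>+\<omega>. ennreal (max (\<bar>V m \<omega>\<bar> - R) 0) \<partial>M)"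
      by (rule nn_integral_liminf) simp
    also have "\<dots> = liminf (\<lambda>m. ennreal (\<integral>\<omega>. max (\<bar>V m \<omega>\<bar> - R) 0 \<partial>M))"
      by (intro arg_cong[where f = liminf] ext nn_integral_eq_integral tail_int) auto
    also have "\<dots> \<le> ennreal e"
      by (intro Liminf_le always_eventually allI ennreal_leI R) simp
    finally show ?thesis .
  qed
  obtain R1 where R1: "0 \<le> R1" "\<And>m. (\<integral>\<omega>. max (\<bar>V m \<omega>\<bar> - R1) 0 \<partial>M) \<le> 1"
    using ui[of 1] by auto
  have "(\<integral>\<^sup>+\<omega>. ennreal (norm (W \<omega>)) \<partial>M) \<le> (\<integral>\<^sup>+\<omega>. ennreal R1 + ennreal (max (\<bar>W \<omega>\<bar> - R1) 0) \<partial>M)"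
    using R1(1) by (intro nn_integral_mono, subst ennreal_plus[symmetric])
      (auto intro!: ennreal_leI simp del: ennreal_plus)
  also have "\<dots> = ennreal R1 * emeasure M (space M) + (\<integral>\<^sup>+\<omega>. ennreal (max (\<bar>W \<omega>\<bar> - R1) 0) \<partial>M)"
    by (simp add: nn_integral_add)
  also have "\<dots> < \<infinity>"
    using fatou[OF R1(2)] by (simp add: ennreal_mult_less_top emeasure_eq_measure order_le_less_trans)
  finally show intW: "integrable M W"
    by (intro integrableI_bounded) auto
  show "(\<lambda>m. \<integral>\<omega>. V m \<omega> \<partial>M) \<longlonglongrightarrow> (\<integral>\<omega>. W \<omega> \<partial>M)"
  proof (rule LIMSEQ_I)
    fix r :: real assume "0 < r"
    \<comment> \<open>Three errors of size \<open>e\<close> are added: clamping \<open>V m\<close>,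
      clamping \<open>W\<close>, and the distance of the clamped integrals.\<close>
    define e where "e = r / 4"
    have "0 < e" using \<open>0 < r\<close> by (simp add: e_def)
    then obtain R where R: "0 \<le> R" "\<And>m. (\<integral>\<omega>. max (\<bar>V m \<omega>\<bar> - R) 0 \<partial>M) \<le> e"
      using ui by metis
    define \<psi> where "\<psi> y = max (- R) (min R y)" for y :: real
    have \<psi>_int: "integrable M (\<lambda>\<omega>. \<psi> (Z \<omega>))" if [measurable]: "Z \<in> borel_measurable M" for Z
    proof (rule integrable_const_bound)
      show "AE \<omega> in M. norm (\<psi> (Z \<omega>)) \<le> R" using R(1) by (auto simp: \<psi>_def)
    qed (simp add: \<psi>_def)
    have bound: "\<bar>(\<integral>\<omega>. Z \<omega> \<partial>M) - (\<integral>\<omega>. \<psi> (Z \<omega>) \<partial>M)\<bar> \<le> (\<integral>\<omega>. max (\<bar>Z \<omega>\<bar> - R) 0 \<partial>M)"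
      if Z: "integrable M Z" for Z
    proof -
      have [measurable]: "Z \<in> borel_measurable M" using Z by auto
      have "\<bar>(\<integral>\<omega>. Z \<omega> \<partial>M) - (\<integral>\<omega>. \<psi> (Z \<omega>) \<partial>M)\<bar> = \<bar>\<integral>\<omega>. Z \<omega> - \<psi> (Z \<omega>) \<partial>M\<bar>"
        using Z \<psi>_int[of Z] by simp
      also have "\<dots> \<le> (\<integral>\<omega>. \<bar>Z \<omega> - \<psi> (Z \<omega>)\<bar> \<partial>M)"
        by (rule integral_abs_bound)
      also have "\<dots> = (\<integral>\<omega>. max (\<bar>Z \<omega>\<bar> - R) 0 \<partial>M)"
        using R(1) by (intro Bochner_Integration.integral_cong) (auto simp: \<psi>_def)
      finally show ?thesis .
    qed
    have "(\<lambda>m. \<integral>\<omega>. \<psi> (V m \<omega>) \<partial>M) \<longlonglongrightarrow> (\<integral>\<omega>. \<psi> (W \<omega>) \<partial>M)"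
    proof (rule integral_dominated_convergence[where w = "\<lambda>_. R"])
      show "AE \<omega> in M. (\<lambda>m. \<psi> (V m \<omega>)) \<longlonglongrightarrow> \<psi> (W \<omega>)"
        using lim by eventually_elim (auto simp: \<psi>_def intro!: tendsto_intros)
      show "AE \<omega> in M. norm (\<psi> (V m \<omega>)) \<le> R" for m using R(1) by (auto simp: \<psi>_def)
    qed (auto simp: \<psi>_def)
    from LIMSEQ_D[OF this \<open>0 < e\<close>] obtain n0 where
      n0: "\<And>m. n0 \<le> m \<Longrightarrow> \<bar>(\<integral>\<omega>. \<psi> (V m \<omega>) \<partial>M) - (\<integral>\<omega>. \<psi> (W \<omega>) \<partial>M)\<bar> < e"
      by (auto simp: real_norm_def)
    have "(\<integral>\<omega>. max (\<bar>W \<omega>\<bar> - R) 0 \<partial>M) \<le> e"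
      using \<open>0 < e\<close> by (intro integral_real_bounded fatou R less_imp_le)
    with bound[OF intW] have W_near: "\<bar>(\<integral>\<omega>. W \<omega> \<partial>M) - (\<integral>\<omega>. \<psi> (W \<omega>) \<partial>M)\<bar> \<le> e"
      by simp
    have V_near: "\<bar>(\<integral>\<omega>. V m \<omega> \<partial>M) - (\<integral>\<omega>. \<psi> (V m \<omega>) \<partial>M)\<bar> \<le> e" for m
      using bound[OF int[of m]] R(2)[of m] by simp
    have "\<bar>(\<integral>\<omega>. V m \<omega> \<partial>M) - (\<integral>\<omega>. W \<omega> \<partial>M)\<bar> < e + e + e" if "n0 \<le> m" for m
      using n0[OF that] V_near[of m] W_near by linarith
    moreover have "e + e + e < r"
      using \<open>0 < r\<close> by (simp add: e_def)
    ultimately have "\<bar>(\<integral>\<omega>. V m \<omega> \<partial>M) - (\<integral>\<omega>. W \<omega> \<partial>M)\<bar> < r" if "n0 \<le> m" for m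
      using that by (meson less_trans)
    then show "\<exists>no. \<forall>n\<ge>no. norm ((\<integral>\<omega>. V n \<omega> \<partial>M) - (\<integral>\<omega>. W \<omega> \<partial>M)) < r"
      by auto
  qed
qed

lemma stopped_eq: "stopped Y \<rho> t \<omega> = Y (enn2real (min (ennreal t) (\<rho> \<omega>))) \<omega>"
  by (simp add: stopped_def value_at_def)

section \<open>Stopping times under the usual conditions\<close>

context usual_filtered_prob_space
begin

lemma sets_F_subset: "A \<in> sets (F t) \<Longrightarrow> A \<in> sets M"
  using subalgebra_F by (auto simp: subalgebra_def)

lemma sets_F_le: "A \<in> sets (F s) \<Longrightarrow> s \<le> t \<Longrightarrow> A \<in> sets (F t)"
  using sets_F_mono by auto

lemma measurable_F_M: "f \<in> measurable (F t) N \<Longrightarrow> f \<in> measurable M N"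
  using subalgebra_F by (rule measurable_from_subalg)

lemma adapted_measurable: "adapted F Y \<Longrightarrow> 0 \<le> t \<Longrightarrow> Y t \<in> borel_measurable M"
  unfolding adapted_def using measurable_F_M by auto

lemma stopping_time_iff_sets:
  "stopping_time F T \<longleftrightarrow> (\<forall>t. {\<omega> \<in> space M. T \<omega> \<le> t} \<in> sets (F t))"
  by (simp add: stopping_time_def pred_def space_F)

text \<open>For every \<open>s > t\<close> the event \<open>T \<le> t\<close> is a countable
  intersection of events known by time \<open>s\<close>, so right-continuity of the filtration
  places it in \<open>F t\<close>. At \<open>t = \<infinity>\<close> it is the whole space.\<close>

lemma stopping_time_lessI:
  assumes less: "\<And>t. {\<omega> \<in> space M. T \<omega> < t} \<in> sets (F t)"
  shows "stopping_time F T"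
  unfolding stopping_time_iff_sets
proof
  fix t
  show "{\<omega> \<in> space M. T \<omega> \<le> t} \<in> sets (F t)"
  proof (cases "t = \<infinity>")
    case True
    then show ?thesis using sets.top[of "F t"] by (simp add: space_F)
  next
    case False
    then have t: "t < \<infinity>" by (simp add: less_top)
    have "{\<omega> \<in> space M. T \<omega> \<le> t} \<in> sets (F s)" if ts: "t < s" for s
    proof -
      obtain u where u: "\<And>n. t < u n" "u \<longlonglongrightarrow> t"
        using approx_from_above_dense_linorder[OF ts] by auto
      \<comment> \<open>Capping the approximating times at \<open>s\<close> keeps every set of the
        intersection in \<open>F s\<close>, including those with small \<open>n\<close>.\<close>
      have "{\<omega> \<in> space M. T \<omega> \<le> t} = (\<Inter>n::nat. {\<omega> \<in> space M. T \<omega> < min (u n) s})"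
      proof safe
        fix \<omega> n assume "T \<omega> \<le> t"
        then show "T \<omega> < min (u n) s" using u(1)[of n] ts by auto
      next
        fix \<omega> assume *: "\<omega> \<in> (\<Inter>n. {\<omega> \<in> space M. T \<omega> < min (u n) s})"
        then show "T \<omega> \<le> t"
          by (intro LIMSEQ_le_const[OF u(2)]) (auto intro: less_imp_le)
      qed auto
      also have "\<dots> \<in> sets (F s)"
      proof (rule sets.countable_INT)
        show "range (\<lambda>n. {\<omega> \<in> space M. T \<omega> < min (u n) s}) \<subseteq> sets (F s)"
          using sets_F_le[OF less min.cobounded2] by blast
      qed simp
      finally show ?thesis .
    qed
    then show ?thesis by (simp add: right_continuous_F[OF t])
  qed
qed

text \<open>An entrance before \<open>t\<close> is witnessed at a rational time before
  \<open>t\<close>, so the event is a countable union of sets in \<open>F t\<close>. The strict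
  inequality is what the previous criterion asks for.\<close>

lemma stopping_time_entrance:
  assumes "\<And>q. 0 \<le> q \<Longrightarrow> {\<omega> \<in> space M. P \<omega> q} \<in> sets (F (ennreal q))"
  shows "stopping_time F (\<lambda>\<omega>. entrance_time (P \<omega>))"
proof (rule stopping_time_lessI)
  fix t
  have "{\<omega> \<in> space M. entrance_time (P \<omega>) < t}
      = (\<Union>q\<in>{q \<in> \<rat>. 0 \<le> q \<and> ennreal q < t}. {\<omega> \<in> space M. P \<omega> q})"
    by (auto simp: entrance_time_def INF_less_iff)
  also have "\<dots> \<in> sets (F t)"
  proof (rule sets.countable_UN'')
    show "countable {q \<in> \<rat>. 0 \<le> q \<and> ennreal q < t}"
      by (rule countable_subset[OF _ countable_rat]) auto
    show "{\<omega> \<in> space M. P \<omega> q} \<in> sets (F t)" if "q \<in> {q \<in> \<rat>. 0 \<le> q \<and> ennreal q < t}" for q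
      using sets_F_le[OF assms[of q], of t] that by (simp add: less_imp_le)
  qed
  finally show "{\<omega> \<in> space M. entrance_time (P \<omega>) < t} \<in> sets (F t)" .
qed

lemma stopping_time_SUP:
  fixes T :: "nat \<Rightarrow> 'a \<Rightarrow> ennreal"
  assumes "\<And>n. stopping_time F (T n)"
  shows "stopping_time F (\<lambda>\<omega>. SUP n. T n \<omega>)"
  unfolding stopping_time_iff_sets
proof
  fix t
  have "{\<omega> \<in> space M. (SUP n. T n \<omega>) \<le> t} = (\<Inter>n. {\<omega> \<in> space M. T n \<omega> \<le> t})"
    by (auto simp: SUP_le_iff)
  also have "\<dots> \<in> sets (F t)"
    using assms unfolding stopping_time_iff_sets by (intro sets.countable_INT) auto
  finally show "{\<omega> \<in> space M. (SUP n. T n \<omega>) \<le> t} \<in> sets (F t)" .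
qed

text \<open>The sublevel sets differ by subsets of a null set, which belong to \<open>F 0\<close> by
  completeness. This will turn the hitting time, known only to equal a stopping time almost surely,
  into a stopping time.\<close>

lemma stopping_time_AE_cong:
  assumes "stopping_time F S" "AE \<omega> in M. S \<omega> = T \<omega>"
  shows "stopping_time F T"
  unfolding stopping_time_iff_sets
proof
  fix t
  let ?S = "{\<omega> \<in> space M. S \<omega> \<le> t}" and ?T = "{\<omega> \<in> space M. T \<omega> \<le> t}"
  have S: "?S \<in> sets (F t)"
    using assms(1) by (simp add: stopping_time_iff_sets)
  have null: "{\<omega> \<in> space M. S \<omega> \<noteq> T \<omega>} \<in> null_sets M"
    using assms(2) by (simp add: AE_iff_null_sets)
  have *: "B \<in> sets (F t)" if "B \<subseteq> {\<omega> \<in> space M. S \<omega> \<noteq> T \<omega>}" for B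
    using complete2[OF that null] null_sets_F sets_F_le[of B 0 t] by auto
  have "?T = ?S \<union> (?T - ?S) - (?S - ?T)"
    by auto
  also have "\<dots> \<in> sets (F t)"
    by (intro sets.Un sets.Diff S *) auto
  finally show "?T \<in> sets (F t)" .
qed

text \<open>\<open>J m\<close> is the index of the grid point obtained by rounding the stopped time
  up on the grid of mesh \<open>t / Suc m\<close>. Rounding up makes the chosen point known at its
  own grid time, and it approaches the stopped time from the right, where the paths are
  continuous.\<close>

lemma discretize_stopping_time:
  fixes \<rho> :: "'a \<Rightarrow> ennreal" and t :: real
  assumes \<rho>: "stopping_time F \<rho>" and t: "0 < t"
  obtains J :: "nat \<Rightarrow> 'a \<Rightarrow> nat" where
    "\<And>m \<omega>. J m \<omega> \<le> Suc m"
    "\<And>m j. {\<omega> \<in> space M. J m \<omega> = j} \<in> sets (F (ennreal (t * real j / real (Suc m))))"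
    "\<And>m \<omega>. enn2real (min (ennreal t) (\<rho> \<omega>)) \<le> t * real (J m \<omega>) / real (Suc m)"
    "\<And>m \<omega>. t * real (J m \<omega>) / real (Suc m) \<le> enn2real (min (ennreal t) (\<rho> \<omega>)) + t / real (Suc m)"
proof -
  define r where "r \<omega> = enn2real (min (ennreal t) (\<rho> \<omega>))" for \<omega>
  have r0: "0 \<le> r \<omega>" for \<omega> by (simp add: r_def)
  have r: "min (ennreal t) (\<rho> \<omega>) = ennreal (r \<omega>)" for \<omega>
    unfolding r_def by (subst ennreal_enn2real) (auto simp: min_less_iff_disj)
  have rt: "r \<omega> \<le> t" for \<omega>
    using min.cobounded1[of "ennreal t" "\<rho> \<omega>"] t by (simp add: r)
  define h where "h m = t / real (Suc m)" for m
  have h: "0 < h m" for m using t by (simp add: h_def)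
  have ht: "t = real (Suc m) * h m" for m by (simp add: h_def)
  define J where "J m \<omega> = nat \<lceil>r \<omega> / h m\<rceil>" for m \<omega>
  have J_iff: "J m \<omega> \<le> j \<longleftrightarrow> r \<omega> \<le> h m * real j" for m \<omega> j
  proof -
    have "J m \<omega> \<le> j \<longleftrightarrow> \<lceil>r \<omega> / h m\<rceil> \<le> int j"
      by (simp add: J_def nat_le_iff)
    also have "\<dots> \<longleftrightarrow> r \<omega> / h m \<le> real j"
      by (simp add: ceiling_le_iff)
    also have "\<dots> \<longleftrightarrow> r \<omega> \<le> h m * real j"
      using h[of m] by (simp add: pos_divide_le_eq mult.commute)
    finally show ?thesis .
  qed
  have le: "{\<omega> \<in> space M. J m \<omega> \<le> j} \<in> sets (F (ennreal (h m * real j)))" for m j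
  proof -
    have "{\<omega> \<in> space M. J m \<omega> \<le> j} = {\<omega> \<in> space M. min (ennreal t) (\<rho> \<omega>) \<le> ennreal (h m * real j)}"
      unfolding r using h[of m] by (auto simp: J_iff ennreal_le_iff)
    also have "\<dots> \<in> sets (F (ennreal (h m * real j)))"
      using stopping_time_min[OF stopping_time_const \<rho>] by (simp add: stopping_time_iff_sets)
    finally show ?thesis .
  qed
  show ?thesis
  proof (rule that[of J])
    show "J m \<omega> \<le> Suc m" for m \<omega>
      unfolding J_iff using rt[of \<omega>] ht[of m] by (simp add: mult.commute)
    have eq: "t * real j / real (Suc m) = h m * real j" for m j by (simp add: h_def)
    show "{\<omega> \<in> space M. J m \<omega> = j} \<in> sets (F (ennreal (t * real j / real (Suc m))))" for m j
      unfolding eq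
    proof (cases j)
      case 0
      then show "{\<omega> \<in> space M. J m \<omega> = j} \<in> sets (F (ennreal (h m * real j)))"
        using le[of m 0] by simp
    next
      case (Suc i)
      have "{\<omega> \<in> space M. J m \<omega> \<le> i} \<in> sets (F (ennreal (h m * real j)))"
        using h[of m] by (intro sets_F_le[OF le] ennreal_leI mult_left_mono) (auto simp: Suc)
      moreover have "{\<omega> \<in> space M. J m \<omega> = j} = {\<omega> \<in> space M. J m \<omega> \<le> j} - {\<omega> \<in> space M. J m \<omega> \<le> i}"
        by (auto simp: Suc)
      ultimately show "{\<omega> \<in> space M. J m \<omega> = j} \<in> sets (F (ennreal (h m * real j)))"
        using le[of m j] by auto
    qed
    show "enn2real (min (ennreal t) (\<rho> \<omega>)) \<le> t * real (J m \<omega>) / real (Suc m)" for m \<omega>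
      unfolding eq r_def[symmetric] J_iff[symmetric] by simp
    have "real (J m \<omega>) \<le> r \<omega> / h m + 1" for m \<omega>
      using r0[of \<omega>] h[of m] unfolding J_def by (simp add: of_nat_ceiling)
    then have "h m * real (J m \<omega>) \<le> h m * (r \<omega> / h m + 1)" for m \<omega>
      using h[of m] by (intro mult_left_mono) auto
    also have "h m * (r \<omega> / h m + 1) = r \<omega> + h m" for m \<omega>
      using h[of m] by (simp add: field_simps)
    finally show "t * real (J m \<omega>) / real (Suc m) \<le> enn2real (min (ennreal t) (\<rho> \<omega>)) + t / real (Suc m)" for m \<omega>
      unfolding eq r_def[symmetric] h_def[symmetric] .
  qed
qed

section \<open>Optional stopping by discretization from the right\<close>

definition right_continuous_paths :: "(real \<Rightarrow> 'a \<Rightarrow> real) \<Rightarrow> bool" where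
  "right_continuous_paths Y \<longleftrightarrow> (AE \<omega> in M. \<forall>t\<ge>0. ((\<lambda>s. Y s \<omega>) \<longlongrightarrow> Y t \<omega>) (at_right t))"

lemma discretized_tendsto:
  assumes J: "\<And>m. enn2real (min (ennreal t) (\<rho> \<omega>)) \<le> t * real (J m) / real (Suc m)"
    "\<And>m. t * real (J m) / real (Suc m) \<le> enn2real (min (ennreal t) (\<rho> \<omega>)) + t / real (Suc m)"
    and Y: "\<forall>t\<ge>0. ((\<lambda>s. Y s \<omega>) \<longlongrightarrow> Y t \<omega>) (at_right t)"
  shows "(\<lambda>m. Y (t * real (J m) / real (Suc m)) \<omega>) \<longlonglongrightarrow> stopped Y \<rho> t \<omega>"
proof -
  define r where "r = enn2real (min (ennreal t) (\<rho> \<omega>))"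
  have "continuous (at r within {r..}) (\<lambda>s. Y s \<omega>)"
    using Y by (simp add: continuous_within at_within_Ici_at_right r_def)
  moreover have "\<And>m. t * real (J m) / real (Suc m) \<in> {r..}"
    using J(1) by (auto simp: r_def simp del: of_nat_Suc)
  moreover have "(\<lambda>m. t * real (J m) / real (Suc m)) \<longlonglongrightarrow> r"
  proof (rule tendsto_sandwich[of "\<lambda>_. r" _ _ "\<lambda>m. r + t / real (Suc m)"])
    show "(\<lambda>m. r + t / real (Suc m)) \<longlonglongrightarrow> r" by real_asymp
  qed (use J in \<open>auto simp: r_def simp del: of_nat_Suc\<close>)
  ultimately show ?thesis
    unfolding stopped_eq r_def[symmetric] by (rule continuous_within_tendsto_compose')
qed

lemma discretized_measurable:
  assumes "adapted F Y" "0 \<le> t"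
    "\<And>j. {\<omega> \<in> space M. J \<omega> = j} \<in> sets (F (ennreal (t * real j / real (Suc m))))"
  shows "(\<lambda>\<omega>. Y (t * real (J \<omega>) / real (Suc m)) \<omega>) \<in> borel_measurable M"
proof (rule measurable_compose_countable[where f = "\<lambda>j \<omega>. Y (t * real j / real (Suc m)) \<omega>" and g = J])
  show "(\<lambda>\<omega>. Y (t * real j / real (Suc m)) \<omega>) \<in> borel_measurable M" for j
    using assms by (intro adapted_measurable) auto
  have "J -` {j} \<inter> space M \<in> sets M" for j
    using sets_F_subset[OF assms(3)[of j]] by (simp add: vimage_def Int_def conj_commute)
  then show "J \<in> measurable M (count_space UNIV)"
    by (simp add: measurable_count_space_eq2_countable)
qed

lemma stopped_measurable:
  assumes Y: "adapted F Y" "right_continuous_paths Y" and \<rho>: "stopping_time F \<rho>" and "0 \<le> t"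
  shows "stopped Y \<rho> t \<in> borel_measurable M"
proof (cases "t = 0")
  case True
  then have "stopped Y \<rho> t = Y 0"
    by (auto simp: stopped_eq)
  then show ?thesis
    using adapted_measurable[OF Y(1), of 0] by simp
next
  case False
  then have t: "0 < t" using assms by simp
  obtain J where J: "\<And>m \<omega>. J m \<omega> \<le> Suc m"
    "\<And>m j. {\<omega> \<in> space M. J m \<omega> = j} \<in> sets (F (ennreal (t * real j / real (Suc m))))"
    "\<And>m \<omega>. enn2real (min (ennreal t) (\<rho> \<omega>)) \<le> t * real (J m \<omega>) / real (Suc m)"
    "\<And>m \<omega>. t * real (J m \<omega>) / real (Suc m) \<le> enn2real (min (ennreal t) (\<rho> \<omega>)) + t / real (Suc m)"
    by (rule discretize_stopping_time[OF \<rho> t]) blast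
  let ?V = "\<lambda>m \<omega>. Y (t * real (J m \<omega>) / real (Suc m)) \<omega>"
  \<comment> \<open>\<open>lim\<close> is unspecified where the sequence diverges; this can happen
    only on a null set, which completeness absorbs.\<close>
  have "(\<lambda>\<omega>. lim (\<lambda>m. ?V m \<omega>)) \<in> borel_measurable M"
    using J(2) assms by (intro borel_measurable_lim_metric discretized_measurable) auto
  moreover have "AE \<omega> in M. lim (\<lambda>m. ?V m \<omega>) = stopped Y \<rho> t \<omega>"
    using Y(2) unfolding right_continuous_paths_def
    by eventually_elim (intro limI discretized_tendsto J)
  ultimately show ?thesis
    by (rule borel_measurable_AE_cong)
qed

lemma martingale_set_integral:
  assumes Y: "martingale M F Y" and st: "0 \<le> s" "s \<le> t" and B: "B \<in> sets (F (ennreal s))"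
  shows "(\<integral>\<omega>. indicator B \<omega> * Y s \<omega> \<partial>M) = (\<integral>\<omega>. indicator B \<omega> * Y t \<omega> \<partial>M)"
proof -
  interpret S: sigma_finite_subalgebra M "F (ennreal s)"
    by (intro finite_measure_subalgebra_is_sigma_finite finite_measure_subalgebra.intro
      finite_measure_axioms finite_measure_subalgebra_axioms.intro subalgebra_F)
  have int: "integrable M (Y s)" "integrable M (Y t)"
    and cond: "AE \<omega> in M. real_cond_exp M (F (ennreal s)) (Y t) \<omega> = Y s \<omega>"
    using Y st unfolding martingale_def by auto
  have [measurable]: "B \<in> sets M" using B by (rule sets_F_subset)
  have [measurable]: "Y s \<in> borel_measurable M" using int by auto
  have "(\<integral>\<omega>\<in>B. Y t \<omega> \<partial>M) = (\<integral>\<omega>\<in>B. real_cond_exp M (F (ennreal s)) (Y t) \<omega> \<partial>M)"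
    using int(2) B by (rule S.real_cond_exp_intA)
  also have "\<dots> = (\<integral>\<omega>\<in>B. Y s \<omega> \<partial>M)"
    unfolding set_lebesgue_integral_def using cond borel_measurable_cond_exp2
    by (intro integral_cong_AE) auto
  finally show ?thesis
    by (simp add: set_lebesgue_integral_def)
qed

text \<open>The submartingale property of the absolute value: \<open>B\<close> is split by the sign
  of \<open>Y s\<close>, which is known at time \<open>s\<close>. The martingale identity holds on
  each part, and there plus or minus \<open>Y t\<close> is at most its absolute value.\<close>

lemma martingale_set_integral_abs:
  assumes Y: "martingale M F Y" and st: "0 \<le> s" "s \<le> t" and B: "B \<in> sets (F (ennreal s))"
  shows "(\<integral>\<omega>. indicator B \<omega> * \<bar>Y s \<omega>\<bar> \<partial>M) \<le> (\<integral>\<omega>. indicator B \<omega> * \<bar>Y t \<omega>\<bar> \<partial>M)"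
proof -
  have int: "integrable M (Y s)" "integrable M (Y t)"
    using Y st unfolding martingale_def by auto
  have BM[measurable]: "B \<in> sets M" using B by (rule sets_F_subset)
  define P where "P = {\<omega> \<in> space M. 0 \<le> Y s \<omega>}"
  have "P \<in> sets (F (ennreal s))"
  proof -
    have "Y s \<in> borel_measurable (F (ennreal s))"
      using Y st unfolding martingale_def adapted_def by auto
    then have "{\<omega> \<in> space (F (ennreal s)). 0 \<le> Y s \<omega>} \<in> sets (F (ennreal s))"
      by measurable
    then show ?thesis by (simp add: P_def space_F)
  qed
  then have BP: "B \<inter> P \<in> sets (F (ennreal s))" "B - P \<in> sets (F (ennreal s))"
    using B by auto
  then have [measurable]: "B \<inter> P \<in> sets M" "B - P \<in> sets M"
    using sets_F_subset by auto
  have i: "integrable M (\<lambda>\<omega>. indicator C \<omega> * f \<omega>)" if "C \<in> sets M" "integrable M f" for C and f :: "'a \<Rightarrow> real"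
    using integrable_mult_indicator[OF that] by simp
  have "(\<integral>\<omega>. indicator B \<omega> * \<bar>Y s \<omega>\<bar> \<partial>M)
      = (\<integral>\<omega>. indicator (B \<inter> P) \<omega> * Y s \<omega> - indicator (B - P) \<omega> * Y s \<omega> \<partial>M)"
    by (intro Bochner_Integration.integral_cong) (auto simp: P_def indicator_def)
  also have "\<dots> = (\<integral>\<omega>. indicator (B \<inter> P) \<omega> * Y s \<omega> \<partial>M) - (\<integral>\<omega>. indicator (B - P) \<omega> * Y s \<omega> \<partial>M)"
    by (intro Bochner_Integration.integral_diff i int) measurable
  also have "\<dots> = (\<integral>\<omega>. indicator (B \<inter> P) \<omega> * Y t \<omega> \<partial>M) - (\<integral>\<omega>. indicator (B - P) \<omega> * Y t \<omega> \<partial>M)"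
    by (simp only: martingale_set_integral[OF Y st BP(1)] martingale_set_integral[OF Y st BP(2)])
  also have "\<dots> = (\<integral>\<omega>. indicator (B \<inter> P) \<omega> * Y t \<omega> - indicator (B - P) \<omega> * Y t \<omega> \<partial>M)"
    by (intro Bochner_Integration.integral_diff[symmetric] i int) measurable
  also have "\<dots> \<le> (\<integral>\<omega>. indicator B \<omega> * \<bar>Y t \<omega>\<bar> \<partial>M)"
    by (intro integral_mono Bochner_Integration.integrable_diff i int BM integrable_abs) (auto simp: indicator_def)
  finally show ?thesis .
qed

text \<open>At grid times the mean is that of \<open>Y t\<close>, by summation over the finitely
  many grid points. Right-continuity gives almost sure convergence to the stopped value. Convergence
  of the means needs uniform integrability, which holds because all \<open>V m\<close> are
  controlled by the single integrable function \<open>Y t\<close>.\<close>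

lemma optional_stopping:
  assumes Y: "martingale M F Y" "right_continuous_paths Y" and \<rho>: "stopping_time F \<rho>" and "0 \<le> t"
  shows "integrable M (stopped Y \<rho> t)" and "(\<integral>\<omega>. stopped Y \<rho> t \<omega> \<partial>M) = (\<integral>\<omega>. Y 0 \<omega> \<partial>M)"
proof -
  have adY: "adapted F Y" and intY: "\<And>s. 0 \<le> s \<Longrightarrow> integrable M (Y s)"
    using Y(1) by (auto simp: martingale_def)
  have "integrable M (stopped Y \<rho> t) \<and> (\<integral>\<omega>. stopped Y \<rho> t \<omega> \<partial>M) = (\<integral>\<omega>. Y 0 \<omega> \<partial>M)"
  proof (cases "t = 0")
    case True
    then have "stopped Y \<rho> t = Y 0"
      by (auto simp: stopped_eq)
    then show ?thesis using intY[of 0] by simp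
  next
    case False
    then have t: "0 < t" using \<open>0 \<le> t\<close> by simp
    obtain J where J: "\<And>m \<omega>. J m \<omega> \<le> Suc m"
      "\<And>m j. {\<omega> \<in> space M. J m \<omega> = j} \<in> sets (F (ennreal (t * real j / real (Suc m))))"
      "\<And>m \<omega>. enn2real (min (ennreal t) (\<rho> \<omega>)) \<le> t * real (J m \<omega>) / real (Suc m)"
      "\<And>m \<omega>. t * real (J m \<omega>) / real (Suc m) \<le> enn2real (min (ennreal t) (\<rho> \<omega>)) + t / real (Suc m)"
      by (rule discretize_stopping_time[OF \<rho> t]) blast
    define h where "h m j = t * real j / real (Suc m)" for m j
    have h: "0 \<le> h m j" "j \<le> Suc m \<Longrightarrow> h m j \<le> t" for m j
    proof -
      show "0 \<le> h m j"
        using t by (simp add: h_def)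
      assume "j \<le> Suc m"
      then have "t * real j \<le> t * real (Suc m)"
        using t by (intro mult_left_mono) auto
      then show "h m j \<le> t"
        by (simp add: h_def pos_divide_le_eq del: of_nat_Suc)
    qed
    define V where "V m \<omega> = Y (h m (J m \<omega>)) \<omega>" for m \<omega>
    define D where "D m j = {\<omega> \<in> space M. J m \<omega> = j}" for m j
    have DF: "D m j \<in> sets (F (ennreal (h m j)))" for m j
      using J(2) by (simp add: D_def h_def)
    have DM[measurable]: "D m j \<in> sets M" for m j
      using DF by (rule sets_F_subset)
    have VM[measurable]: "V m \<in> borel_measurable M" for m
      using J(2) t unfolding V_def h_def by (intro discretized_measurable adY) auto
    have i: "integrable M (\<lambda>\<omega>. indicator C \<omega> * f \<omega>)" if "C \<in> sets M" "integrable M f"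
      for C and f :: "'a \<Rightarrow> real"
      using integrable_mult_indicator[OF that] by simp
    \<comment> \<open>Evaluation at a random index becomes a finite sum over deterministic indices,
      to which the martingale property applies term by term.\<close>
    have split: "G (J m \<omega>) \<omega> = (\<Sum>j\<le>Suc m. indicator (D m j) \<omega> * G j \<omega>)"
      if "\<omega> \<in> space M" for m \<omega> and G :: "nat \<Rightarrow> 'a \<Rightarrow> real"
    proof -
      have "(\<Sum>j\<le>Suc m. indicator (D m j) \<omega> * G j \<omega>) = (\<Sum>j\<le>Suc m. if j = J m \<omega> then G j \<omega> else 0)"
        using that by (intro sum.cong) (auto simp: D_def indicator_def)
      then show ?thesis using J(1)[of m \<omega>] by (simp add: sum.delta)
    qed
    have split_int: "integrable M (\<lambda>\<omega>. G (J m \<omega>) \<omega>)"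
        "(\<integral>\<omega>. G (J m \<omega>) \<omega> \<partial>M) = (\<Sum>j\<le>Suc m. \<integral>\<omega>. indicator (D m j) \<omega> * G j \<omega> \<partial>M)"
      if "\<And>j. j \<le> Suc m \<Longrightarrow> integrable M (G j)" for m and G :: "nat \<Rightarrow> 'a \<Rightarrow> real"
    proof -
      have *: "integrable M (\<lambda>\<omega>. indicator (D m j) \<omega> * G j \<omega>)" if "j \<in> {..Suc m}" for j
        using that by (intro i DM \<open>\<And>j. j \<le> Suc m \<Longrightarrow> integrable M (G j)\<close>) auto
      have "integrable M (\<lambda>\<omega>. G (J m \<omega>) \<omega>) \<longleftrightarrow>
          integrable M (\<lambda>\<omega>. \<Sum>j\<le>Suc m. indicator (D m j) \<omega> * G j \<omega>)"
        by (rule Bochner_Integration.integrable_cong[OF refl split])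
      then show "integrable M (\<lambda>\<omega>. G (J m \<omega>) \<omega>)"
        using * by (simp only:) (rule Bochner_Integration.integrable_sum)
      have "(\<integral>\<omega>. G (J m \<omega>) \<omega> \<partial>M) = (\<integral>\<omega>. (\<Sum>j\<le>Suc m. indicator (D m j) \<omega> * G j \<omega>) \<partial>M)"
        by (rule Bochner_Integration.integral_cong[OF refl split])
      also have "\<dots> = (\<Sum>j\<le>Suc m. \<integral>\<omega>. indicator (D m j) \<omega> * G j \<omega> \<partial>M)"
        using * by (rule Bochner_Integration.integral_sum)
      finally show "(\<integral>\<omega>. G (J m \<omega>) \<omega> \<partial>M) = (\<Sum>j\<le>Suc m. \<integral>\<omega>. indicator (D m j) \<omega> * G j \<omega> \<partial>M)" .
    qed
    have intV: "integrable M (V m)" for m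
      using split_int(1)[of m "\<lambda>j. Y (h m j)"] intY h(1) unfolding V_def by simp
    have EV: "(\<integral>\<omega>. V m \<omega> \<partial>M) = (\<integral>\<omega>. Y t \<omega> \<partial>M)" for m
    proof -
      have "(\<integral>\<omega>. V m \<omega> \<partial>M) = (\<Sum>j\<le>Suc m. \<integral>\<omega>. indicator (D m j) \<omega> * Y (h m j) \<omega> \<partial>M)"
        unfolding V_def by (intro split_int(2)[of m "\<lambda>j. Y (h m j)"] intY h)
      also have "\<dots> = (\<Sum>j\<le>Suc m. \<integral>\<omega>. indicator (D m j) \<omega> * Y t \<omega> \<partial>M)"
        by (intro sum.cong refl martingale_set_integral Y h DF) auto
      also have "\<dots> = (\<integral>\<omega>. Y t \<omega> \<partial>M)"
        using split_int(2)[of m "\<lambda>j. Y t"] intY t by simp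
      finally show ?thesis .
    qed
    \<comment> \<open>The excess is at most the absolute value on the event that \<open>R\<close> is
      exceeded. On each part \<open>D m j\<close> this event is known at the grid time, so the value
      there can be replaced by the one at \<open>t\<close>.\<close>
    have tail: "(\<integral>\<omega>. max (\<bar>V m \<omega>\<bar> - R) 0 \<partial>M) \<le> (\<integral>\<omega>. indicator {\<omega> \<in> space M. R < \<bar>V m \<omega>\<bar>} \<omega> * \<bar>Y t \<omega>\<bar> \<partial>M)"
      if "0 \<le> R" for m R
    proof -
      define B where "B j = {\<omega> \<in> space M. R < \<bar>Y (h m j) \<omega>\<bar>}" for j
      have BF: "B j \<in> sets (F (ennreal (h m j)))" for j
      proof -
        have "Y (h m j) \<in> borel_measurable (F (ennreal (h m j)))"
          using adY h(1) by (simp add: adapted_def)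
        then have "{\<omega> \<in> space (F (ennreal (h m j))). R < \<bar>Y (h m j) \<omega>\<bar>} \<in> sets (F (ennreal (h m j)))"
          by measurable
        then show ?thesis by (simp add: B_def space_F)
      qed
      have BM[measurable]: "B j \<in> sets M" for j using BF by (rule sets_F_subset)
      have int1: "integrable M (\<lambda>\<omega>. indicator (B j) \<omega> * \<bar>Y s \<omega>\<bar>)" if "0 \<le> s" for s j
        using intY[OF that] by (intro i BM integrable_abs)
      have "(\<integral>\<omega>. max (\<bar>V m \<omega>\<bar> - R) 0 \<partial>M) \<le> (\<integral>\<omega>. indicator (B (J m \<omega>)) \<omega> * \<bar>Y (h m (J m \<omega>)) \<omega>\<bar> \<partial>M)"
      proof (rule integral_mono)
        show "integrable M (\<lambda>\<omega>. max (\<bar>V m \<omega>\<bar> - R) 0)"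
          using intV by (intro integrable_max integrable_diff integrable_abs) auto
        show "integrable M (\<lambda>\<omega>. indicator (B (J m \<omega>)) \<omega> * \<bar>Y (h m (J m \<omega>)) \<omega>\<bar>)"
          by (rule split_int(1)[of m "\<lambda>j \<omega>. indicator (B j) \<omega> * \<bar>Y (h m j) \<omega>\<bar>"]) (intro int1 h)
      qed (use that in \<open>auto simp: V_def B_def indicator_def\<close>)
      also have "\<dots> = (\<Sum>j\<le>Suc m. \<integral>\<omega>. indicator (D m j) \<omega> * (indicator (B j) \<omega> * \<bar>Y (h m j) \<omega>\<bar>) \<partial>M)"
        by (rule split_int(2)[of m "\<lambda>j \<omega>. indicator (B j) \<omega> * \<bar>Y (h m j) \<omega>\<bar>"]) (intro int1 h)
      also have "\<dots> = (\<Sum>j\<le>Suc m. \<integral>\<omega>. indicator (D m j \<inter> B j) \<omega> * \<bar>Y (h m j) \<omega>\<bar> \<partial>M)"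
        by (simp add: indicator_inter_arith mult.assoc)
      also have "\<dots> \<le> (\<Sum>j\<le>Suc m. \<integral>\<omega>. indicator (D m j \<inter> B j) \<omega> * \<bar>Y t \<omega>\<bar> \<partial>M)"
        by (intro sum_mono martingale_set_integral_abs Y h sets.Int DF BF) auto
      also have "\<dots> = (\<Sum>j\<le>Suc m. \<integral>\<omega>. indicator (D m j) \<omega> * (indicator (B j) \<omega> * \<bar>Y t \<omega>\<bar>) \<partial>M)"
        by (simp add: indicator_inter_arith mult.assoc)
      also have "\<dots> = (\<integral>\<omega>. indicator (B (J m \<omega>)) \<omega> * \<bar>Y t \<omega>\<bar> \<partial>M)"
        using t by (intro split_int(2)[of m "\<lambda>j \<omega>. indicator (B j) \<omega> * \<bar>Y t \<omega>\<bar>", symmetric] int1) auto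
      also have "\<dots> = (\<integral>\<omega>. indicator {\<omega> \<in> space M. R < \<bar>V m \<omega>\<bar>} \<omega> * \<bar>Y t \<omega>\<bar> \<partial>M)"
        by (intro Bochner_Integration.integral_cong) (auto simp: V_def B_def indicator_def)
      finally show ?thesis .
    qed
    define C where "C = (\<integral>\<omega>. \<bar>Y t \<omega>\<bar> \<partial>M)"
    have intYt: "integrable M (Y t)" using intY t by simp
    then have [measurable]: "Y t \<in> borel_measurable M" by auto
    have C0: "0 \<le> C" by (simp add: C_def)
    have EabsV: "(\<integral>\<omega>. \<bar>V m \<omega>\<bar> \<partial>M) \<le> C" for m
    proof -
      have "(\<integral>\<omega>. \<bar>V m \<omega>\<bar> \<partial>M) = (\<integral>\<omega>. max (\<bar>V m \<omega>\<bar> - 0) 0 \<partial>M)" by simp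
      also note tail[of 0 m]
      also have "(\<integral>\<omega>. indicator {\<omega> \<in> space M. 0 < \<bar>V m \<omega>\<bar>} \<omega> * \<bar>Y t \<omega>\<bar> \<partial>M) \<le> C"
        unfolding C_def using intYt by (intro integral_mono i integrable_abs) (auto simp: indicator_def)
      finally show ?thesis by simp
    qed
    have markov: "R * prob {\<omega> \<in> space M. R < \<bar>V m \<omega>\<bar>} \<le> C" if "0 \<le> R" for R m
    proof -
      have "R * prob {\<omega> \<in> space M. R < \<bar>V m \<omega>\<bar>} = (\<integral>\<omega>. indicator {\<omega> \<in> space M. R < \<bar>V m \<omega>\<bar>} \<omega> * R \<partial>M)"
        by simp
      also have "\<dots> \<le> (\<integral>\<omega>. \<bar>V m \<omega>\<bar> \<partial>M)"
        using intV by (intro integral_mono i integrable_abs) (auto simp: indicator_def)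
      finally show ?thesis using EabsV[of m] by simp
    qed
    have ui: "\<exists>R\<ge>0. \<forall>m. (\<integral>\<omega>. max (\<bar>V m \<omega>\<bar> - R) 0 \<partial>M) \<le> e" if "0 < e" for e
    proof -
      have "(\<lambda>n. \<integral>\<omega>. indicator {\<omega> \<in> space M. real n < \<bar>Y t \<omega>\<bar>} \<omega> * \<bar>Y t \<omega>\<bar> \<partial>M) \<longlonglongrightarrow> (\<integral>\<omega>. 0 \<partial>M)"
      proof (rule integral_dominated_convergence[where w = "\<lambda>\<omega>. \<bar>Y t \<omega>\<bar>"])
        show "AE \<omega> in M. (\<lambda>n. indicator {\<omega> \<in> space M. real n < \<bar>Y t \<omega>\<bar>} \<omega> * \<bar>Y t \<omega>\<bar>) \<longlonglongrightarrow> 0"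
        proof (rule AE_I2)
          fix \<omega>
          obtain n0 :: nat where n0: "\<bar>Y t \<omega>\<bar> \<le> real n0" using real_arch_simple by blast
          have "\<forall>\<^sub>F n in sequentially. indicator {\<omega> \<in> space M. real n < \<bar>Y t \<omega>\<bar>} \<omega> * \<bar>Y t \<omega>\<bar> = 0"
            using eventually_ge_at_top[of n0] by eventually_elim (use n0 in \<open>auto simp: indicator_def\<close>)
          then show "(\<lambda>n. indicator {\<omega> \<in> space M. real n < \<bar>Y t \<omega>\<bar>} \<omega> * \<bar>Y t \<omega>\<bar>) \<longlonglongrightarrow> 0"
            by (rule tendsto_eventually)
        qed
      qed (use intYt in \<open>auto simp: indicator_def\<close>)
      then have "\<forall>\<^sub>F n in sequentially. (\<integral>\<omega>. indicator {\<omega> \<in> space M. real n < \<bar>Y t \<omega>\<bar>} \<omega> * \<bar>Y t \<omega>\<bar> \<partial>M) < e / 2"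
        using that by (intro order_tendstoD) auto
      then obtain L :: nat where L: "(\<integral>\<omega>. indicator {\<omega> \<in> space M. real L < \<bar>Y t \<omega>\<bar>} \<omega> * \<bar>Y t \<omega>\<bar> \<partial>M) < e / 2"
        by (auto simp: eventually_sequentially)
      \<comment> \<open>Below, \<open>\<bar>Y t\<bar>\<close> is split at \<open>L\<close>. The
        upper part contributes less than \<open>e / 2\<close>; the lower part contributes at most
        \<open>L\<close> times a probability bounded by \<open>C / R\<close>, which is at most
        \<open>e / 2\<close> for this \<open>R\<close>. The summand 1 keeps \<open>R\<close>
        positive.\<close>
      define R where "R = 2 * real L * C / e + 1"
      have R: "0 < R" using C0 that by (auto simp: R_def intro!: add_nonneg_pos)
      have "(\<integral>\<omega>. max (\<bar>V m \<omega>\<bar> - R) 0 \<partial>M) \<le> e" for m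
      proof -
        let ?G = "{\<omega> \<in> space M. R < \<bar>V m \<omega>\<bar>}"
        have "(\<integral>\<omega>. max (\<bar>V m \<omega>\<bar> - R) 0 \<partial>M) \<le> (\<integral>\<omega>. indicator ?G \<omega> * \<bar>Y t \<omega>\<bar> \<partial>M)"
          using tail[of R m] R by simp
        also have "\<dots> \<le> (\<integral>\<omega>. indicator {\<omega> \<in> space M. real L < \<bar>Y t \<omega>\<bar>} \<omega> * \<bar>Y t \<omega>\<bar> + indicator ?G \<omega> * real L \<partial>M)"
          using intYt by (intro integral_mono Bochner_Integration.integrable_add i integrable_abs)
            (auto simp: indicator_def)
        also have "\<dots> = (\<integral>\<omega>. indicator {\<omega> \<in> space M. real L < \<bar>Y t \<omega>\<bar>} \<omega> * \<bar>Y t \<omega>\<bar> \<partial>M) + (\<integral>\<omega>. indicator ?G \<omega> * real L \<partial>M)"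
          using intYt by (intro Bochner_Integration.integral_add i integrable_abs) auto
        also have "(\<integral>\<omega>. indicator ?G \<omega> * real L \<partial>M) = real L * prob ?G"
          by simp
        also have "real L * prob ?G \<le> e / 2"
        proof -
          have "R * (real L * prob ?G) \<le> real L * C"
            using mult_left_mono[OF markov[of R m], of "real L"] R by (simp add: mult_ac)
          also have "\<dots> \<le> R * (e / 2)"
            using that by (simp add: R_def field_simps)
          finally show ?thesis using R by simp
        qed
        finally show ?thesis using L by simp
      qed
      then show ?thesis using R by (intro exI[of _ R]) auto
    qed
    have lim: "AE \<omega> in M. (\<lambda>m. V m \<omega>) \<longlonglongrightarrow> stopped Y \<rho> t \<omega>"
      using Y(2) unfolding right_continuous_paths_def V_def h_def
      by eventually_elim (intro discretized_tendsto J)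
    have meas: "stopped Y \<rho> t \<in> borel_measurable M"
      by (intro stopped_measurable adY Y \<rho> \<open>0 \<le> t\<close>)
    have "(\<lambda>m. \<integral>\<omega>. V m \<omega> \<partial>M) \<longlonglongrightarrow> (\<integral>\<omega>. stopped Y \<rho> t \<omega> \<partial>M)"
      by (rule integral_tendsto_uniformly_integrable(2)[OF intV lim meas ui])
    then have "(\<integral>\<omega>. stopped Y \<rho> t \<omega> \<partial>M) = (\<integral>\<omega>. Y t \<omega> \<partial>M)"
      by (simp add: EV LIMSEQ_const_iff)
    moreover have "(\<integral>\<omega>. Y t \<omega> \<partial>M) = (\<integral>\<omega>. Y 0 \<omega> \<partial>M)"
    proof -
      have "(\<integral>\<omega>. indicator (space M) \<omega> * Y s \<omega> \<partial>M) = (\<integral>\<omega>. Y s \<omega> \<partial>M)" for s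
        by (intro Bochner_Integration.integral_cong) auto
      then show ?thesis
        using martingale_set_integral[OF Y(1) order_refl \<open>0 \<le> t\<close>, of "space M"] sets.top[of "F (ennreal 0)"]
        by (simp add: space_F)
    qed
    ultimately show ?thesis
      using integral_tendsto_uniformly_integrable(1)[OF intV lim meas ui] by simp
  qed
  then show "integrable M (stopped Y \<rho> t)" and "(\<integral>\<omega>. stopped Y \<rho> t \<omega> \<partial>M) = (\<integral>\<omega>. Y 0 \<omega> \<partial>M)"
    by auto
qed

end

section \<open>The primitive of the weight\<close>

lemma bounded_set_integrable:
  fixes g :: "real \<Rightarrow> real"
  assumes [measurable]: "g \<in> borel_measurable borel" and "\<And>z. u \<le> z \<Longrightarrow> z \<le> v \<Longrightarrow> \<bar>g z\<bar> \<le> B"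
  shows "set_integrable lborel {u..v} g"
  unfolding set_integrable_def
proof (rule integrableI_bounded_set_indicator[where B = B])
  show "AE z in lborel. z \<in> {u..v} \<longrightarrow> norm (g z) \<le> B"
    using assms(2) by auto
qed (auto simp: emeasure_lborel_Icc_eq)

lemma set_integral_Icc_split:
  fixes g :: "real \<Rightarrow> real"
  assumes "u \<le> v" "v \<le> w" "set_integrable lborel {u..w} g"
  shows "(LINT z:{u..w}|lborel. g z) = (LINT z:{u..v}|lborel. g z) + (LINT z:{v..w}|lborel. g z)"
proof -
  have *: "(LINT z:{p..q}|lborel. g z) = integral {p..q} g" if "u \<le> p" "q \<le> w" for p q
    using that by (intro set_borel_integral_eq_integral set_integrable_subset[OF assms(3)]) auto
  have "g integrable_on {u..w}"
    using assms(3) by (rule set_borel_integral_eq_integral)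
  then show ?thesis
    using assms(1,2) by (simp add: * Henstock_Kurzweil_Integration.integral_combine)
qed

lemma set_integral_Icc_self: "(LINT z:{c..c}|lborel. g z) = (0::real)" for c :: real
  unfolding set_lebesgue_integral_def
proof (rule integral_eq_zero_AE)
  show "AE z in lborel. indicator {c..c} z *\<^sub>R g z = 0"
    using AE_lborel_singleton[of c] by eventually_elim simp
qed

locale weight_function =
  fixes \<phi> :: "real \<Rightarrow> real"
  assumes phi_measurable[measurable]: "\<phi> \<in> borel_measurable borel"
    and phi_nonneg: "\<And>y. 0 \<le> \<phi> y"
    and phi_bounded: "\<And>b. \<exists>K>0. \<forall>y\<in>{0..b}. \<phi> y \<le> K"
begin

definition \<Phi> :: "real \<Rightarrow> real" where
  "\<Phi> y = (LINT z:{0..y}|lborel. \<phi> z)"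

lemma phi_set_integrable: "0 \<le> u \<Longrightarrow> set_integrable lborel {u..v} \<phi>"
proof -
  assume "0 \<le> u"
  obtain K where "\<forall>y\<in>{0..v}. \<phi> y \<le> K" using phi_bounded[of v] by auto
  with \<open>0 \<le> u\<close> show ?thesis
    by (intro bounded_set_integrable[where B = K]) (auto simp: phi_nonneg abs_of_nonneg)
qed

lemma Phi_diff: "0 \<le> u \<Longrightarrow> u \<le> v \<Longrightarrow> \<Phi> v - \<Phi> u = (LINT z:{u..v}|lborel. \<phi> z)"
  unfolding \<Phi>_def by (subst set_integral_Icc_split[of 0 u v]) (auto intro: phi_set_integrable)

lemma Phi_mono: "u \<le> v \<Longrightarrow> \<Phi> u \<le> \<Phi> v"
proof (cases "0 \<le> u")
  case True
  assume "u \<le> v"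
  then have "0 \<le> \<Phi> v - \<Phi> u"
    unfolding Phi_diff[OF True \<open>u \<le> v\<close>] set_lebesgue_integral_def
    by (intro Bochner_Integration.integral_nonneg) (auto simp: phi_nonneg)
  then show ?thesis by simp
next
  case False
  then have "\<Phi> u = 0" by (simp add: \<Phi>_def set_lebesgue_integral_def)
  moreover have "0 \<le> \<Phi> v"
    unfolding \<Phi>_def set_lebesgue_integral_def
    by (intro Bochner_Integration.integral_nonneg) (auto simp: phi_nonneg)
  ultimately show ?thesis by simp
qed

lemma Phi_0: "\<Phi> 0 = 0"
  unfolding \<Phi>_def by (rule set_integral_Icc_self)

lemma Phi_nonneg: "0 \<le> y \<Longrightarrow> 0 \<le> \<Phi> y"
  using Phi_mono[of 0 y] by (simp add: Phi_0)

lemma Phi_measurable[measurable]: "\<Phi> \<in> borel_measurable borel"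
  by (rule borel_measurable_mono) (auto simp: mono_def Phi_mono)

lemma exp_Phi_set_integrable:
  assumes "0 \<le> u"
  shows "set_integrable lborel {u..v} (\<lambda>z. exp (\<Phi> z) * \<phi> z)"
proof -
  obtain K where "0 < K" "\<forall>y\<in>{0..v}. \<phi> y \<le> K" using phi_bounded[of v] by auto
  with assms show ?thesis
    by (intro bounded_set_integrable[where B = "exp (\<Phi> v) * K"])
      (auto simp: phi_nonneg abs_mult abs_of_nonneg intro!: mult_mono Phi_mono)
qed

text \<open>\<open>\<Phi>\<close> is only Lipschitz, so the fundamental theorem of calculus does not apply directly. But both
  sides have increments between \<open>exp (\<Phi> u) * (\<Phi> v - \<Phi> u)\<close> and \<open>exp (\<Phi> v) * (\<Phi> v - \<Phi> u)\<close>,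
  hence their difference has derivative \<open>0\<close>.\<close>

lemma exp_Phi_integral:
  assumes "0 \<le> y"
  shows "(LINT z:{0..y}|lborel. exp (\<Phi> z) * \<phi> z) = exp (\<Phi> y) - 1"
proof -
  define \<Psi> where "\<Psi> v = (LINT z:{0..v}|lborel. exp (\<Phi> z) * \<phi> z)" for v
  define D where "D v = \<Psi> v - exp (\<Phi> v)" for v
  obtain K where K: "0 < K" "\<forall>z\<in>{0..y}. \<phi> z \<le> K" using phi_bounded[of y] by auto
  have ord: "\<bar>D v - D u\<bar> \<le> exp (\<Phi> y) * K\<^sup>2 * (v - u)\<^sup>2" if uv: "0 \<le> u" "u \<le> v" "v \<le> y" for u v
  proof -
    have \<Psi>: "\<Psi> v - \<Psi> u = (LINT z:{u..v}|lborel. exp (\<Phi> z) * \<phi> z)"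
      unfolding \<Psi>_def using uv
      by (subst set_integral_Icc_split[of 0 u v]) (auto intro: exp_Phi_set_integrable)
    let ?d = "\<Phi> v - \<Phi> u"
    have d0: "0 \<le> ?d" using Phi_mono uv by simp
    have c: "(LINT z:{u..v}|lborel. c * \<phi> z) = c * ?d" for c
      using Phi_diff[OF uv(1,2)] by simp
    have int: "set_integrable lborel {u..v} (\<lambda>z. c * \<phi> z)" for c
      using phi_set_integrable[OF uv(1)] by simp
    have l: "exp (\<Phi> u) * ?d \<le> \<Psi> v - \<Psi> u"
      unfolding \<Psi> c[symmetric]
      by (intro set_integral_mono int exp_Phi_set_integrable uv mult_right_mono phi_nonneg)
        (auto intro: Phi_mono)
    have r: "\<Psi> v - \<Psi> u \<le> exp (\<Phi> v) * ?d"
      unfolding \<Psi> c[symmetric]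
      by (intro set_integral_mono int exp_Phi_set_integrable uv mult_right_mono phi_nonneg)
        (auto intro: Phi_mono)
    \<comment> \<open>This bound and the next are \<open>1 + z \<le> exp z\<close> at
      \<open>z = ?d\<close> and at \<open>z = - ?d\<close>.\<close>
    have l': "exp (\<Phi> u) * ?d \<le> exp (\<Phi> v) - exp (\<Phi> u)"
    proof -
      have "exp (\<Phi> u) * (1 + ?d) \<le> exp (\<Phi> u) * exp ?d"
        by (intro mult_left_mono exp_ge_add_one_self) auto
      then show ?thesis by (simp add: exp_diff algebra_simps)
    qed
    have r': "exp (\<Phi> v) - exp (\<Phi> u) \<le> exp (\<Phi> v) * ?d"
    proof -
      have "exp (\<Phi> v) * (1 + - ?d) \<le> exp (\<Phi> v) * exp (- ?d)"
        by (intro mult_left_mono exp_ge_add_one_self) auto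
      then show ?thesis by (simp add: exp_diff algebra_simps)
    qed
    \<comment> \<open>Both increments lie in the same interval, of length
      \<open>(exp (\<Phi> v) - exp (\<Phi> u)) * ?d\<close>. The first factor is itself of order
      \<open>?d\<close>, so the bound is quadratic in \<open>v - u\<close>.\<close>
    have "\<bar>D v - D u\<bar> \<le> (exp (\<Phi> v) - exp (\<Phi> u)) * ?d"
      using l r l' r' unfolding D_def by (simp add: algebra_simps abs_le_iff)
    also have "\<dots> \<le> (exp (\<Phi> v) * ?d) * ?d"
      using r' d0 by (rule mult_right_mono)
    also have "\<dots> \<le> (exp (\<Phi> y) * (K * (v - u))) * (K * (v - u))"
    proof -
      have "?d \<le> (LINT z:{u..v}|lborel. K)"
        unfolding Phi_diff[OF uv(1,2)] using K uv
        by (intro set_integral_mono phi_set_integrable bounded_set_integrable[where B = "\<bar>K\<bar>"]) auto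
      also have "\<dots> = K * (v - u)"
        using uv by (simp add: set_lebesgue_integral_def)
      finally have "?d \<le> K * (v - u)" .
      moreover have "exp (\<Phi> v) \<le> exp (\<Phi> y)" using Phi_mono uv by simp
      ultimately show ?thesis using d0 by (intro mult_mono) auto
    qed
    finally show ?thesis by (simp add: power2_eq_square mult_ac)
  qed
  have D: "\<bar>D v - D u\<bar> \<le> exp (\<Phi> y) * K\<^sup>2 * (v - u)\<^sup>2" if "u \<in> {0..y}" "v \<in> {0..y}" for u v
    using ord[of u v] ord[of v u] that
    by (cases "u \<le> v") (auto simp: abs_minus_commute power2_commute[of u v])
  have "(D has_derivative (\<lambda>_. 0)) (at u within {0..y})" if u: "u \<in> {0..y}" for u
  proof (rule has_derivativeI_sandwich[where e = 1 and H = "\<lambda>v. exp (\<Phi> y) * K\<^sup>2 * \<bar>v - u\<bar>"])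
    show "norm (D v - D u - 0) / norm (v - u) \<le> exp (\<Phi> y) * K\<^sup>2 * \<bar>v - u\<bar>"
      if "v \<in> {0..y}" "v \<noteq> u" for v
    proof -
      have "(v - u)\<^sup>2 = \<bar>v - u\<bar> * \<bar>v - u\<bar>"
        by (simp only: power2_eq_square abs_mult_self_eq)
      then have "\<bar>D v - D u\<bar> \<le> exp (\<Phi> y) * K\<^sup>2 * \<bar>v - u\<bar> * \<bar>v - u\<bar>"
        using D[OF u that(1)] by (simp only: mult.assoc)
      then show ?thesis
        using that(2) by (simp add: pos_divide_le_eq)
    qed
    have "((\<lambda>v. exp (\<Phi> y) * K\<^sup>2 * \<bar>v - u\<bar>) \<longlongrightarrow> exp (\<Phi> y) * K\<^sup>2 * \<bar>u - u\<bar>) (at u within {0..y})"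
      by (intro tendsto_intros)
    then show "((\<lambda>v. exp (\<Phi> y) * K\<^sup>2 * \<bar>v - u\<bar>) \<longlongrightarrow> 0) (at u within {0..y})" by simp
  qed auto
  then obtain c where c: "\<And>v. v \<in> {0..y} \<Longrightarrow> D v = c"
    using has_derivative_zero_constant[of "{0..y}" D] by (auto simp: convex_real_interval)
  have "\<Psi> 0 = 0"
    unfolding \<Psi>_def by (rule set_integral_Icc_self)
  then have "D 0 = -1" by (simp add: D_def Phi_0)
  with c[of 0] c[of y] assms have "D y = -1" by simp
  then show ?thesis by (simp add: D_def \<Psi>_def)
qed

text \<open>A bound at the integers would bound the whole integral by monotone convergence, as the
  intervals \<open>{0..real n}\<close> exhaust the half-line.\<close>

lemma Phi_unbounded:
  assumes "(\<integral>\<^sup>+z\<in>{0..}. ennreal (\<phi> z) \<partial>lborel) = \<infinity>"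
  shows "\<exists>n::nat. B < \<Phi> (real n)"
proof (rule ccontr)
  assume "\<not> ?thesis"
  then have B: "\<Phi> (real n) \<le> B" for n by (meson not_le)
  have "(\<integral>\<^sup>+z\<in>{0..}. ennreal (\<phi> z) \<partial>lborel)
      = (\<integral>\<^sup>+z. (SUP n. ennreal (\<phi> z) * indicator {0..real n} z) \<partial>lborel)"
  proof (intro nn_integral_cong)
    fix z :: real
    obtain n0 :: nat where n0: "z \<le> real n0" using real_arch_simple by blast
    show "ennreal (\<phi> z) * indicator {0..} z = (SUP n. ennreal (\<phi> z) * indicator {0..real n} z)"
    proof (rule antisym)
      have "ennreal (\<phi> z) * indicator {0..} z = ennreal (\<phi> z) * indicator {0..real n0} z"
        using n0 by (auto simp: indicator_def)
      also have "\<dots> \<le> (SUP n. ennreal (\<phi> z) * indicator {0..real n} z)"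
        by (rule SUP_upper) simp
      finally show "ennreal (\<phi> z) * indicator {0..} z \<le> (SUP n. ennreal (\<phi> z) * indicator {0..real n} z)" .
      show "(SUP n. ennreal (\<phi> z) * indicator {0..real n} z) \<le> ennreal (\<phi> z) * indicator {0..} z"
        by (rule SUP_least) (auto simp: indicator_def)
    qed
  qed
  also have "\<dots> = (SUP n. \<integral>\<^sup>+z. ennreal (\<phi> z) * indicator {0..real n} z \<partial>lborel)"
    by (rule nn_integral_monotone_convergence_SUP)
      (auto simp: incseq_def le_fun_def indicator_def)
  also have "\<dots> \<le> ennreal B"
  proof (rule SUP_least)
    fix n
    have "(\<integral>\<^sup>+z. ennreal (\<phi> z) * indicator {0..real n} z \<partial>lborel) = (\<integral>\<^sup>+z. ennreal (indicator {0..real n} z *\<^sub>R \<phi> z) \<partial>lborel)"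
      by (intro nn_integral_cong) (auto simp: indicator_def)
    also have "\<dots> = ennreal (\<Phi> (real n))"
      unfolding \<Phi>_def set_lebesgue_integral_def
      using phi_set_integrable[of 0 "real n"] unfolding set_integrable_def
      by (intro nn_integral_eq_integral) (auto simp: phi_nonneg)
    also have "\<dots> \<le> ennreal B" by (intro ennreal_leI B)
    finally show "(\<integral>\<^sup>+z. ennreal (\<phi> z) * indicator {0..real n} z \<partial>lborel) \<le> ennreal B" .
  qed
  finally show False using assms by (simp add: top_unique)
qed

end

section \<open>The law of the stopped process\<close>

text \<open>The path properties are gathered into the single almost sure statement
  \<open>paths\<close>, so that a proof can fix a typical outcome and interpret the pathwise locale
  there. The localizing sequence is fixed once for all statements.\<close>

locale sigma_process = usual_filtered_prob_space M F + weight_function \<phi>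
  for M :: "'a measure" and F :: "ennreal \<Rightarrow> 'a measure" and \<phi> :: "real \<Rightarrow> real" +
  fixes X N A :: "real \<Rightarrow> 'a \<Rightarrow> real" and \<tau> :: "nat \<Rightarrow> 'a \<Rightarrow> ennreal"
  assumes X_adapted: "adapted F X" and A_adapted: "adapted F A"
    and paths: "AE \<omega> in M. weighted_sigma_path (\<lambda>t. X t \<omega>) (\<lambda>t. A t \<omega>) \<phi>"
    and decomposition: "AE \<omega> in M. \<forall>t\<ge>0. X t \<omega> = N t \<omega> + A t \<omega>"
    and localizing: "localizing M F \<tau>"
    and N_martingale: "\<And>n. martingale M F (\<lambda>t \<omega>. stopped N (\<tau> n) t \<omega> - N 0 \<omega>)"
    and A_unbounded: "AE \<omega> in M. filterlim (\<lambda>t. A t \<omega>) at_top at_top"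
begin

lemma X_right_continuous: "right_continuous_paths X"
  unfolding right_continuous_paths_def using paths
  by eventually_elim (auto simp: weighted_sigma_path_def sigma_path_def)

lemma A_right_continuous: "right_continuous_paths A"
  unfolding right_continuous_paths_def using paths
proof eventually_elim
  case (elim \<omega>)
  then interpret P: weighted_sigma_path "\<lambda>t. X t \<omega>" "\<lambda>t. A t \<omega>" \<phi> .
  show ?case using P.a_right by simp
qed

lemma stopping_time_localizing: "stopping_time F (\<tau> n)"
  using localizing by (simp add: localizing_def)

lemma N_stopped_right_continuous: "right_continuous_paths (\<lambda>t \<omega>. stopped N (\<tau> n) t \<omega> - N 0 \<omega>)"
  unfolding right_continuous_paths_def using decomposition
    X_right_continuous[unfolded right_continuous_paths_def]
    A_right_continuous[unfolded right_continuous_paths_def]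
proof eventually_elim
  case (elim \<omega>)
  have N: "((\<lambda>s. N s \<omega>) \<longlongrightarrow> N t \<omega>) (at_right t)" if "0 \<le> t" for t
  proof -
    have "((\<lambda>s. X s \<omega> - A s \<omega>) \<longlongrightarrow> X t \<omega> - A t \<omega>) (at_right t)"
      using elim(2,3) that by (intro tendsto_diff) auto
    moreover have "\<forall>\<^sub>F s in at_right t. X s \<omega> - A s \<omega> = N s \<omega>"
      using eventually_at_right_less[of t] by eventually_elim (use elim(1) that in auto)
    ultimately have "((\<lambda>s. N s \<omega>) \<longlongrightarrow> X t \<omega> - A t \<omega>) (at_right t)"
      by (rule Lim_transform_eventually)
    then show ?thesis using elim(1) that by simp
  qed
  show ?case
  proof (intro allI impI tendsto_diff tendsto_const)
    fix t :: real assume t: "0 \<le> t"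
    show "((\<lambda>s. stopped N (\<tau> n) s \<omega>) \<longlongrightarrow> stopped N (\<tau> n) t \<omega>) (at_right t)"
    proof (cases "\<tau> n \<omega> \<le> ennreal t")
      case True
      have "\<forall>\<^sub>F s in at_right t. stopped N (\<tau> n) t \<omega> = stopped N (\<tau> n) s \<omega>"
        using eventually_at_right_less[of t]
      proof eventually_elim
        case (elim s)
        then have "ennreal t \<le> ennreal s" by (intro ennreal_leI) simp
        with True have "\<tau> n \<omega> \<le> ennreal s" by (rule order_trans)
        with True show ?case by (simp add: stopped_eq min_def)
      qed
      with tendsto_const show ?thesis by (rule Lim_transform_eventually)
    next
      case False
      then have lt: "ennreal t < \<tau> n \<omega>" by simp
      then obtain z where z: "ennreal t < z" "z < \<tau> n \<omega>" using dense by blast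
      then obtain u where u: "z = ennreal u" "0 \<le> u" by (cases z) auto
      with z t have "t < u" by (simp add: ennreal_less_iff)
      then have "\<forall>\<^sub>F s in at_right t. s < u \<and> t < s"
        by (intro eventually_conj eventually_at_right_less order_tendstoD(2)[OF tendsto_ident_at])
      then have "\<forall>\<^sub>F s in at_right t. N s \<omega> = stopped N (\<tau> n) s \<omega>"
      proof eventually_elim
        case (elim s)
        then have "ennreal s \<le> ennreal u" by (intro ennreal_leI) simp
        with z(2) u(1) have "ennreal s < \<tau> n \<omega>" by (simp add: order_le_less_trans)
        then show ?case using elim t by (simp add: stopped_eq min_absorb1 less_imp_le)
      qed
      with N[OF t] have "((\<lambda>s. stopped N (\<tau> n) s \<omega>) \<longlongrightarrow> N t \<omega>) (at_right t)"
        by (rule Lim_transform_eventually)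
      then show ?thesis using lt t by (simp add: stopped_eq min_absorb1 less_imp_le)
    qed
  qed
qed

lemma optional_stopping_level:
  fixes n :: nat
  assumes \<sigma>: "stopping_time F \<sigma>" and t: "0 \<le> t" and b: "0 \<le> b"
  defines "\<rho> \<equiv> \<lambda>\<omega>. min (\<sigma> \<omega>) (\<tau> n \<omega>)"
  shows "(\<integral>\<^sup>+\<omega>. ennreal (stopped X \<rho> t \<omega>) * indicator {..b} (stopped A \<rho> t \<omega>) \<partial>M)
    = (\<integral>\<^sup>+\<omega>. ennreal (min (stopped A \<rho> t \<omega>) b) \<partial>M)"
proof -
  define L where "L \<omega> = entrance_time (\<lambda>q. b < A q \<omega>)" for \<omega>
  have L: "stopping_time F L"
    unfolding L_def
  proof (rule stopping_time_entrance)
    fix q :: real assume "0 \<le> q"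
    then have "A q \<in> borel_measurable (F (ennreal q))"
      using A_adapted by (simp add: adapted_def)
    then have "{\<omega> \<in> space (F (ennreal q)). b < A q \<omega>} \<in> sets (F (ennreal q))"
      by measurable
    then show "{\<omega> \<in> space M. b < A q \<omega>} \<in> sets (F (ennreal q))"
      by (simp add: space_F)
  qed
  have \<rho>: "stopping_time F \<rho>"
    unfolding \<rho>_def by (intro stopping_time_min \<sigma> stopping_time_localizing)
  have [measurable]: "stopped X \<rho> t \<in> borel_measurable M" "stopped A \<rho> t \<in> borel_measurable M"
    by (intro stopped_measurable X_adapted A_adapted X_right_continuous A_right_continuous \<rho> t)+
  let ?Y = "\<lambda>t \<omega>. stopped N (\<tau> n) t \<omega> - N 0 \<omega>"
  let ?S = "stopped ?Y (\<lambda>\<omega>. min (\<sigma> \<omega>) (L \<omega>)) t"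
  have os: "integrable M ?S" "(\<integral>\<omega>. ?S \<omega> \<partial>M) = (\<integral>\<omega>. ?Y 0 \<omega> \<partial>M)"
    by (rule optional_stopping[OF N_martingale N_stopped_right_continuous
        stopping_time_min[OF \<sigma> L] t])+
  have "?Y 0 \<omega> = 0" for \<omega> by (simp add: stopped_eq)
  then have ES: "(\<integral>\<omega>. ?S \<omega> \<partial>M) = 0" by (simp add: os(2))
  have fin: "ennreal (enn2real (min (ennreal t) z)) = min (ennreal t) z" for z
    by (subst ennreal_enn2real) (auto simp: min_less_iff_disj)
  have S: "AE \<omega> in M. 0 \<le> stopped X \<rho> t \<omega> \<and> 0 \<le> stopped A \<rho> t \<omega> \<and>
      ?S \<omega> = stopped X \<rho> t \<omega> * indicator {..b} (stopped A \<rho> t \<omega>) - min (stopped A \<rho> t \<omega>) b"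
    using paths decomposition
  proof eventually_elim
    case (elim \<omega>)
    then interpret P: weighted_sigma_path "\<lambda>t. X t \<omega>" "\<lambda>t. A t \<omega>" \<phi> by simp
    define v where "v = enn2real (min (ennreal t) (\<rho> \<omega>))"
    have v0: "0 \<le> v" by (simp add: v_def)
    have v: "ennreal v = min (ennreal t) (\<rho> \<omega>)" unfolding v_def by (rule fin)
    \<comment> \<open>The time \<open>\<tau> n\<close> is already built into the martingale, which
      is therefore stopped only at the minimum of \<open>\<sigma>\<close> and \<open>L\<close>. All
      minima together amount to the minimum of \<open>v\<close> and \<open>L\<close>.\<close>
    have "min (ennreal (enn2real (min (ennreal t) (min (\<sigma> \<omega>) (L \<omega>))))) (\<tau> n \<omega>) = min (ennreal v) (L \<omega>)"
      unfolding fin v \<rho>_def by (simp add: min.assoc min.left_commute min.commute)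
    then have "?S \<omega> = N (enn2real (min (ennreal v) (L \<omega>))) \<omega> - N 0 \<omega>"
      by (simp add: stopped_eq)
    also have "N 0 \<omega> = 0" using elim(2) P.x_0 P.a_0 by (metis add_0_right order_refl)
    also have "N (enn2real (min (ennreal v) (L \<omega>))) \<omega>
        = X (enn2real (min (ennreal v) (L \<omega>))) \<omega> - A (enn2real (min (ennreal v) (L \<omega>))) \<omega>"
      using elim(2) by simp
    also have "\<dots> = (if A v \<omega> \<le> b then X v \<omega> else 0) - min (A v \<omega>) b"
      unfolding L_def using P.entrance_level[OF b v0] by simp
    finally show ?case
      using P.x_nonneg[OF v0] P.a_nonneg[OF v0] by (simp add: stopped_eq v_def[symmetric] indicator_def)
  qed
  have intA: "integrable M (\<lambda>\<omega>. min (stopped A \<rho> t \<omega>) b)"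
  proof (rule integrable_const_bound[where B = b])
    show "AE \<omega> in M. norm (min (stopped A \<rho> t \<omega>) b) \<le> b"
      using S by eventually_elim (use b in auto)
  qed simp
  \<comment> \<open>Integrability of the cut-off \<open>X\<close> is a consequence: it is almost
    surely the sum of the stopped martingale and a bounded variable.\<close>
  have "integrable M (\<lambda>\<omega>. ?S \<omega> + min (stopped A \<rho> t \<omega>) b)"
    using os(1) intA by (rule Bochner_Integration.integrable_add)
  moreover have eqAE: "AE \<omega> in M. ?S \<omega> + min (stopped A \<rho> t \<omega>) b
      = stopped X \<rho> t \<omega> * indicator {..b} (stopped A \<rho> t \<omega>)"
    using S by eventually_elim simp
  ultimately have intX: "integrable M (\<lambda>\<omega>. stopped X \<rho> t \<omega> * indicator {..b} (stopped A \<rho> t \<omega>))"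
    by (subst integrable_cong_AE[where g = "\<lambda>\<omega>. ?S \<omega> + min (stopped A \<rho> t \<omega>) b"])
      (use os(1) in auto)
  have "(\<integral>\<omega>. stopped X \<rho> t \<omega> * indicator {..b} (stopped A \<rho> t \<omega>) \<partial>M)
      = (\<integral>\<omega>. ?S \<omega> + min (stopped A \<rho> t \<omega>) b \<partial>M)"
    by (intro integral_cong_AE) (use os(1) eqAE in auto)
  also have "\<dots> = (\<integral>\<omega>. min (stopped A \<rho> t \<omega>) b \<partial>M)"
    using os(1) intA ES by simp
  finally have E: "(\<integral>\<omega>. stopped X \<rho> t \<omega> * indicator {..b} (stopped A \<rho> t \<omega>) \<partial>M)
      = (\<integral>\<omega>. min (stopped A \<rho> t \<omega>) b \<partial>M)" .
  have "(\<integral>\<^sup>+\<omega>. ennreal (stopped X \<rho> t \<omega>) * indicator {..b} (stopped A \<rho> t \<omega>) \<partial>M)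
      = (\<integral>\<^sup>+\<omega>. ennreal (stopped X \<rho> t \<omega> * indicator {..b} (stopped A \<rho> t \<omega>)) \<partial>M)"
    by (intro nn_integral_cong) (auto simp: indicator_def)
  also have "\<dots> = ennreal (\<integral>\<omega>. stopped X \<rho> t \<omega> * indicator {..b} (stopped A \<rho> t \<omega>) \<partial>M)"
    using S by (intro nn_integral_eq_integral intX) (auto elim: eventually_mono)
  also have "\<dots> = (\<integral>\<^sup>+\<omega>. ennreal (min (stopped A \<rho> t \<omega>) b) \<partial>M)"
    unfolding E using S b
    by (intro nn_integral_eq_integral[symmetric] intA) (auto elim: eventually_mono)
  finally show ?thesis .
qed

text \<open>By uniqueness of measures, the identity for levels extends from the functions
  \<open>indicator {..b}\<close> to all Borel functions.\<close>

lemma optional_stopping_nn_integral: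
  fixes n :: nat
  assumes \<sigma>: "stopping_time F \<sigma>" and t: "0 \<le> t"
    and g[measurable]: "g \<in> borel_measurable borel"
  defines "\<rho> \<equiv> \<lambda>\<omega>. min (\<sigma> \<omega>) (\<tau> n \<omega>)"
  shows "(\<integral>\<^sup>+\<omega>. ennreal (stopped X \<rho> t \<omega>) * g (stopped A \<rho> t \<omega>) \<partial>M)
    = (\<integral>\<^sup>+\<omega>. (\<integral>\<^sup>+y. indicator {0..stopped A \<rho> t \<omega>} y * g y \<partial>lborel) \<partial>M)"
proof -
  have \<rho>: "stopping_time F \<rho>"
    unfolding \<rho>_def by (intro stopping_time_min \<sigma> stopping_time_localizing)
  have [measurable]: "stopped X \<rho> t \<in> borel_measurable M" "stopped A \<rho> t \<in> borel_measurable M"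
    by (intro stopped_measurable X_adapted A_adapted X_right_continuous A_right_continuous \<rho> t)+
  have pos: "AE \<omega> in M. 0 \<le> stopped A \<rho> t \<omega>"
    using paths
  proof eventually_elim
    case (elim \<omega>)
    then interpret P: weighted_sigma_path "\<lambda>t. X t \<omega>" "\<lambda>t. A t \<omega>" \<phi> .
    show ?case by (simp add: stopped_eq P.a_nonneg)
  qed
  \<comment> \<open>\<open>\<mu>\<close> is the law of the stopped \<open>A\<close> weighted by the
    stopped \<open>X\<close>. \<open>\<nu>\<close> has at \<open>y \<ge> 0\<close> the Lebesgue
    density given by the probability that the stopped \<open>A\<close> is at least \<open>y\<close>,
    so that integration against it averages primitives, by Tonelli.\<close>
  define \<mu> where "\<mu> = distr (density M (\<lambda>\<omega>. ennreal (stopped X \<rho> t \<omega>))) borel (stopped A \<rho> t)"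
  define \<nu> where "\<nu> = distr (density (M \<Otimes>\<^sub>M lborel)
    (\<lambda>p. indicator {p. 0 \<le> snd p \<and> snd p \<le> stopped A \<rho> t (fst p)} p)) borel snd"
  have nn_\<mu>: "(\<integral>\<^sup>+y. k y \<partial>\<mu>) = (\<integral>\<^sup>+\<omega>. ennreal (stopped X \<rho> t \<omega>) * k (stopped A \<rho> t \<omega>) \<partial>M)"
    if [measurable]: "k \<in> borel_measurable borel" for k
    unfolding \<mu>_def by (subst nn_integral_distr; simp add: nn_integral_density)
  have nn_\<nu>: "(\<integral>\<^sup>+y. k y \<partial>\<nu>) = (\<integral>\<^sup>+\<omega>. (\<integral>\<^sup>+y. indicator {0..stopped A \<rho> t \<omega>} y * k y \<partial>lborel) \<partial>M)"
    if [measurable]: "k \<in> borel_measurable borel" for k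
  proof -
    have "(\<integral>\<^sup>+y. k y \<partial>\<nu>) = (\<integral>\<^sup>+p. indicator {p. 0 \<le> snd p \<and> snd p \<le> stopped A \<rho> t (fst p)} p * k (snd p) \<partial>(M \<Otimes>\<^sub>M lborel))"
      unfolding \<nu>_def by (subst nn_integral_distr; simp add: nn_integral_density)
    also have "\<dots> = (\<integral>\<^sup>+\<omega>. (\<integral>\<^sup>+y. indicator {p. 0 \<le> snd p \<and> snd p \<le> stopped A \<rho> t (fst p)} (\<omega>, y) * k y \<partial>lborel) \<partial>M)"
      by (subst lborel.nn_integral_fst[symmetric]) simp_all
    also have "\<dots> = (\<integral>\<^sup>+\<omega>. (\<integral>\<^sup>+y. indicator {0..stopped A \<rho> t \<omega>} y * k y \<partial>lborel) \<partial>M)"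
      by (intro nn_integral_cong) (auto simp: indicator_def)
    finally show ?thesis .
  qed
  have fin: "(\<integral>\<^sup>+\<omega>. ennreal (min (stopped A \<rho> t \<omega>) b) \<partial>M) \<noteq> \<infinity>" for b
  proof -
    have "(\<integral>\<^sup>+\<omega>. ennreal (min (stopped A \<rho> t \<omega>) b) \<partial>M) \<le> (\<integral>\<^sup>+\<omega>. ennreal b \<partial>M)"
      by (intro nn_integral_mono ennreal_leI) simp
    also have "\<dots> < \<infinity>" by (simp add: emeasure_space_1)
    finally show ?thesis by simp
  qed
  have em_\<mu>: "emeasure \<mu> {..b} = (\<integral>\<^sup>+\<omega>. ennreal (min (stopped A \<rho> t \<omega>) b) \<partial>M)" for b
  proof -
    have "emeasure \<mu> {..b} = (\<integral>\<^sup>+\<omega>. ennreal (stopped X \<rho> t \<omega>) * indicator {..b} (stopped A \<rho> t \<omega>) \<partial>M)"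
      using nn_\<mu>[of "indicator {..b}"] by (simp add: \<mu>_def)
    also have "\<dots> = (\<integral>\<^sup>+\<omega>. ennreal (min (stopped A \<rho> t \<omega>) b) \<partial>M)"
    proof (cases "0 \<le> b")
      case True
      then show ?thesis unfolding \<rho>_def by (intro optional_stopping_level \<sigma> t)
    next
      \<comment> \<open>For negative \<open>b\<close> both sides are 0: \<open>A\<close> is almost
        surely nonnegative, and \<open>ennreal\<close> maps negative numbers to 0.\<close>
      case False
      then show ?thesis
        using pos by (intro nn_integral_cong_AE) (auto elim!: eventually_mono simp: indicator_def ennreal_neg)
    qed
    finally show ?thesis .
  qed
  have em_\<nu>: "emeasure \<nu> {..b} = (\<integral>\<^sup>+\<omega>. ennreal (min (stopped A \<rho> t \<omega>) b) \<partial>M)" for b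
  proof -
    have "emeasure \<nu> {..b} = (\<integral>\<^sup>+\<omega>. (\<integral>\<^sup>+y. indicator {0..stopped A \<rho> t \<omega>} y * indicator {..b} y \<partial>lborel) \<partial>M)"
      using nn_\<nu>[of "indicator {..b}"] by (simp add: \<nu>_def)
    also have "\<dots> = (\<integral>\<^sup>+\<omega>. (\<integral>\<^sup>+y. indicator {0..min (stopped A \<rho> t \<omega>) b} y \<partial>lborel) \<partial>M)"
      by (intro nn_integral_cong) (auto simp: indicator_def)
    also have "\<dots> = (\<integral>\<^sup>+\<omega>. ennreal (min (stopped A \<rho> t \<omega>) b) \<partial>M)"
      by (intro nn_integral_cong) (auto simp: emeasure_lborel_Icc_eq ennreal_neg)
    finally show ?thesis .
  qed
  have "\<mu> = \<nu>"
  proof (rule measure_eqI_generator_eq[where E = "range atMost" and \<Omega> = UNIV and A = "\<lambda>i. {..real i}"])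
    show "Int_stable (range (atMost :: real \<Rightarrow> real set))"
      by (auto simp: Int_stable_def)
    show "emeasure \<mu> B = emeasure \<nu> B" if "B \<in> range atMost" for B
      using that em_\<mu> em_\<nu> by auto
    show "sets \<mu> = sigma_sets UNIV (range atMost)" "sets \<nu> = sigma_sets UNIV (range atMost)"
      by (auto simp: \<mu>_def \<nu>_def borel_eq_atMost image_def)
    show "(\<Union>i. {..real i}) = UNIV"
      using real_arch_simple by auto
    show "emeasure \<mu> {..real i} \<noteq> \<infinity>" for i
      unfolding em_\<mu> by (rule fin)
  qed auto
  then show ?thesis
    using nn_\<mu>[OF g] nn_\<nu>[OF g] by simp
qed

end

section \<open>Values at possibly infinite stopping times and removal of the localization\<close>

lemma (in usual_filtered_prob_space) borel_measurable_stopping_time: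
  "stopping_time F \<sigma> \<Longrightarrow> \<sigma> \<in> borel_measurable M"
  using measurable_stopping_time[of F \<sigma> M] sets_F_subset by (auto simp: space_F)

lemma stopped_eq_value_at:
  assumes "\<rho> \<omega> \<le> ennreal t"
  shows "stopped Y \<rho> t \<omega> = value_at Y \<rho> \<omega>"
  using assms by (simp add: stopped_def value_at_def min_absorb2)

text \<open>Where \<open>\<sigma>\<close> is finite, the process stopped at \<open>\<sigma>\<close>
  and evaluated at time \<open>n\<close> is eventually the value at \<open>\<sigma>\<close>. Where
  \<open>\<sigma>\<close> is infinite it need not converge, hence the value 0 there.\<close>

lemma (in usual_filtered_prob_space) value_at_measurable:
  assumes Y: "adapted F Y" "right_continuous_paths Y" and \<sigma>: "stopping_time F \<sigma>"
  shows "(\<lambda>\<omega>. if \<sigma> \<omega> < \<infinity> then value_at Y \<sigma> \<omega> else 0) \<in> borel_measurable M"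
proof (rule borel_measurable_LIMSEQ_real)
  have [measurable]: "\<sigma> \<in> borel_measurable M"
    using \<sigma> by (rule borel_measurable_stopping_time)
  show "(\<lambda>\<omega>. if \<sigma> \<omega> < \<infinity> then stopped Y \<sigma> (real n) \<omega> else 0) \<in> borel_measurable M" for n
    using stopped_measurable[OF Y \<sigma>, of "real n"] by measurable
  show "(\<lambda>n. if \<sigma> \<omega> < \<infinity> then stopped Y \<sigma> (real n) \<omega> else 0)
      \<longlonglongrightarrow> (if \<sigma> \<omega> < \<infinity> then value_at Y \<sigma> \<omega> else 0)" for \<omega>
  proof (cases "\<sigma> \<omega> < \<infinity>")
    case True
    then obtain s where s: "\<sigma> \<omega> = ennreal s" "0 \<le> s" by (cases "\<sigma> \<omega>") auto
    obtain n0 :: nat where n0: "s \<le> real n0" using real_arch_simple by blast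
    have "\<forall>\<^sub>F n in sequentially. stopped Y \<sigma> (real n) \<omega> = value_at Y \<sigma> \<omega>"
      using eventually_ge_at_top[of n0]
    proof eventually_elim
      case (elim n)
      then have "\<sigma> \<omega> \<le> ennreal (real n)" using n0 unfolding s by (intro ennreal_leI) simp
      then show ?case by (rule stopped_eq_value_at)
    qed
    then show ?thesis using True by (simp add: tendsto_eventually)
  qed simp
qed

context sigma_process
begin

lemma weight_integral:
  assumes "0 \<le> a" "0 \<le> x"
  shows "(\<integral>\<^sup>+y. indicator {0..a} y * (ennreal (exp (\<Phi> y) * \<phi> y) * indicator {..x} y) \<partial>lborel)
    = ennreal (exp (\<Phi> (min a x)) - 1)"
proof -
  have "(\<integral>\<^sup>+y. indicator {0..a} y * (ennreal (exp (\<Phi> y) * \<phi> y) * indicator {..x} y) \<partial>lborel)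
      = (\<integral>\<^sup>+y. ennreal (indicator {0..min a x} y *\<^sub>R (exp (\<Phi> y) * \<phi> y)) \<partial>lborel)"
    by (intro nn_integral_cong) (auto simp: indicator_def)
  also have "\<dots> = ennreal (LINT y:{0..min a x}|lborel. exp (\<Phi> y) * \<phi> y)"
    unfolding set_lebesgue_integral_def
    using exp_Phi_set_integrable[of 0 "min a x"] unfolding set_integrable_def
    by (intro nn_integral_eq_integral) (auto simp: phi_nonneg)
  finally show ?thesis using assms by (simp add: exp_Phi_integral)
qed

lemma eventually_past:
  assumes "(\<lambda>n. \<tau> n \<omega>) \<longlonglongrightarrow> \<infinity>" "0 \<le> s"
  shows "\<forall>\<^sub>F n in sequentially. ennreal s < min (ennreal (real n)) (\<tau> n \<omega>)"
proof -
  obtain n0 :: nat where n0: "s < real n0" using reals_Archimedean2 by blast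
  have "\<forall>\<^sub>F n in sequentially. ennreal s < \<tau> n \<omega>"
    using assms(1) by (rule order_tendstoD) simp
  then show ?thesis
    using eventually_ge_at_top[of n0]
  proof eventually_elim
    case (elim n)
    then have "ennreal s < ennreal (real n)" using n0 assms(2) by (simp add: ennreal_less_iff)
    with elim(1) show ?case by simp
  qed
qed

text \<open>The identity at bounded localized times passes to the limit by dominated convergence:
  since the weight is at most 1 up to \<open>\<sigma>\<close>, the constant
  \<open>exp (\<Phi> x)\<close> dominates both sides. The weight at \<open>\<sigma>\<close> is left
  as a factor, so the result serves the passage times, where it is a level, as well as the announced
  time, where it is still unknown.\<close>

lemma exponential_identity:
  assumes \<sigma>: "stopping_time F \<sigma>" and x: "0 \<le> x"
    and le1: "AE \<omega> in M. \<forall>s\<ge>0. ennreal s \<le> \<sigma> \<omega> \<longrightarrow> \<phi> (A s \<omega>) * X s \<omega> \<le> 1"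
  shows "(\<integral>\<^sup>+\<omega>. ennreal (if \<sigma> \<omega> < \<infinity> \<and> value_at A \<sigma> \<omega> \<le> x
      then exp (\<Phi> (value_at A \<sigma> \<omega>)) * (\<phi> (value_at A \<sigma> \<omega>) * value_at X \<sigma> \<omega>) else 0) \<partial>M)
    = (\<integral>\<^sup>+\<omega>. ennreal ((if \<sigma> \<omega> < \<infinity> then exp (\<Phi> (min (value_at A \<sigma> \<omega>) x)) else exp (\<Phi> x)) - 1) \<partial>M)"
    (is "(\<integral>\<^sup>+\<omega>. ?L \<omega> \<partial>M) = (\<integral>\<^sup>+\<omega>. ?R \<omega> \<partial>M)")
proof -
  define g :: "real \<Rightarrow> ennreal" where "g y = ennreal (exp (\<Phi> y) * \<phi> y) * indicator {..x} y" for y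
  have [measurable]: "g \<in> borel_measurable borel" by (simp add: g_def[abs_def])
  define \<rho> where "\<rho> n \<omega> = min (\<sigma> \<omega>) (\<tau> n \<omega>)" for n \<omega>
  have \<rho>: "stopping_time F (\<rho> n)" for n
    unfolding \<rho>_def by (intro stopping_time_min \<sigma> stopping_time_localizing)
  define X' where "X' n = stopped X (\<rho> n) (real n)" for n
  define A' where "A' n = stopped A (\<rho> n) (real n)" for n
  have [measurable]: "X' n \<in> borel_measurable M" "A' n \<in> borel_measurable M" for n
    unfolding X'_def A'_def
    by (intro stopped_measurable X_adapted A_adapted X_right_continuous A_right_continuous \<rho>; simp)+
  have [measurable]: "\<sigma> \<in> borel_measurable M"
    using \<sigma> by (rule borel_measurable_stopping_time)
  note [measurable] = value_at_measurable[OF X_adapted X_right_continuous \<sigma>]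
    value_at_measurable[OF A_adapted A_right_continuous \<sigma>]
  \<comment> \<open>Measurability is available for the values of \<open>A\<close> and
    \<open>X\<close> set to 0 where \<open>\<sigma>\<close> is infinite; the \<open>let\<close> form
    expresses the integrand through these.\<close>
  have L_eq: "?L = (\<lambda>\<omega>. let a = (if \<sigma> \<omega> < \<infinity> then value_at A \<sigma> \<omega> else 0);
      z = (if \<sigma> \<omega> < \<infinity> then value_at X \<sigma> \<omega> else 0)
      in ennreal (if \<sigma> \<omega> < \<infinity> \<and> a \<le> x then exp (\<Phi> a) * (\<phi> a * z) else 0))"
    by (auto simp: fun_eq_iff Let_def)
  have L_meas: "?L \<in> borel_measurable M"
    unfolding L_eq Let_def by measurable
  have R_eq: "?R = (\<lambda>\<omega>. let a = (if \<sigma> \<omega> < \<infinity> then value_at A \<sigma> \<omega> else 0)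
      in ennreal ((if \<sigma> \<omega> < \<infinity> then exp (\<Phi> (min a x)) else exp (\<Phi> x)) - 1))"
    by (auto simp: fun_eq_iff Let_def)
  have R_meas: "?R \<in> borel_measurable M"
    unfolding R_eq Let_def by measurable
  have loc: "AE \<omega> in M. (\<lambda>n. \<tau> n \<omega>) \<longlonglongrightarrow> \<infinity>"
    using localizing by (auto simp: localizing_def)
  have lims: "AE \<omega> in M. (\<lambda>n. ennreal (X' n \<omega>) * g (A' n \<omega>)) \<longlonglongrightarrow> ?L \<omega> \<and>
      (\<lambda>n. ennreal (exp (\<Phi> (min (A' n \<omega>) x)) - 1)) \<longlonglongrightarrow> ?R \<omega>"
    using paths loc A_unbounded
  proof eventually_elim
    case (elim \<omega>)
    then interpret P: weighted_sigma_path "\<lambda>t. X t \<omega>" "\<lambda>t. A t \<omega>" \<phi> by simp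
    show ?case
    proof (cases "\<sigma> \<omega> < \<infinity>")
      case True
      then obtain s where s: "\<sigma> \<omega> = ennreal s" "0 \<le> s" by (cases "\<sigma> \<omega>") auto
      have x0: "0 \<le> value_at X \<sigma> \<omega>" by (simp add: value_at_def P.x_nonneg)
      have "\<forall>\<^sub>F n in sequentially. X' n \<omega> = value_at X \<sigma> \<omega> \<and> A' n \<omega> = value_at A \<sigma> \<omega>"
        using eventually_past[OF elim(2) s(2)]
      proof eventually_elim
        case (elim n)
        then have "ennreal s \<le> ennreal (real n)" "ennreal s \<le> \<tau> n \<omega>"
          unfolding min_less_iff_conj by (blast intro: less_imp_le)+
        then have "min (ennreal (real n)) (\<rho> n \<omega>) = \<sigma> \<omega>"
          unfolding \<rho>_def s by (simp only: min_absorb1 min_absorb2)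
        then show ?case by (simp add: X'_def A'_def stopped_eq value_at_def)
      qed
      then have "\<forall>\<^sub>F n in sequentially. ennreal (X' n \<omega>) * g (A' n \<omega>) = ?L \<omega>"
          "\<forall>\<^sub>F n in sequentially. ennreal (exp (\<Phi> (min (A' n \<omega>) x)) - 1) = ?R \<omega>"
        using True x0 by (auto elim!: eventually_mono simp: g_def ennreal_mult'[symmetric] phi_nonneg mult_ac)
      then show ?thesis by (auto intro: tendsto_eventually)
    next
      case False
      then have inf: "\<sigma> \<omega> = \<infinity>" by (simp add: less_top[symmetric])
      \<comment> \<open>Where \<open>\<sigma>\<close> is infinite, the growth of \<open>A\<close>
        carries it past the cutoff \<open>x\<close>: \<open>g\<close> eventually vanishes, and the
        minimum is eventually \<open>x\<close>.\<close>
      obtain s0 where s0: "\<And>s. s0 \<le> s \<Longrightarrow> x < A s \<omega>"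
        using elim(3) by (metis filterlim_at_top_dense eventually_at_top_linorder)
      have "\<forall>\<^sub>F n in sequentially. x < A' n \<omega>"
        using eventually_past[OF elim(2) max.cobounded1[of 0 s0]]
      proof eventually_elim
        case (elim n)
        then have less: "ennreal (max 0 s0) < min (ennreal (real n)) (\<rho> n \<omega>)"
          by (simp add: \<rho>_def inf)
        define v where "v = enn2real (min (ennreal (real n)) (\<rho> n \<omega>))"
        have "ennreal v = min (ennreal (real n)) (\<rho> n \<omega>)"
          unfolding v_def by (subst ennreal_enn2real) (auto simp: min_less_iff_disj)
        with less have "max 0 s0 < v" by (metis ennreal_less_iff max.cobounded1)
        then show ?case using s0[of v] by (simp add: A'_def stopped_eq v_def)
      qed
      then have "\<forall>\<^sub>F n in sequentially. ennreal (X' n \<omega>) * g (A' n \<omega>) = ?L \<omega>"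
          "\<forall>\<^sub>F n in sequentially. ennreal (exp (\<Phi> (min (A' n \<omega>) x)) - 1) = ?R \<omega>"
        by (auto elim!: eventually_mono simp: g_def inf)
      then show ?thesis by (auto intro: tendsto_eventually)
    qed
  qed
  have bounds: "AE \<omega> in M. \<forall>n. 0 \<le> A' n \<omega> \<and> ennreal (X' n \<omega>) * g (A' n \<omega>) \<le> ennreal (exp (\<Phi> x)) \<and>
      ennreal (exp (\<Phi> (min (A' n \<omega>) x)) - 1) \<le> ennreal (exp (\<Phi> x))"
    using paths le1
  proof eventually_elim
    case (elim \<omega>)
    then interpret P: weighted_sigma_path "\<lambda>t. X t \<omega>" "\<lambda>t. A t \<omega>" \<phi> by simp
    show ?case
    proof
      fix n
      define v where "v = enn2real (min (ennreal (real n)) (\<rho> n \<omega>))"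
      have v: "ennreal v = min (ennreal (real n)) (\<rho> n \<omega>)"
        unfolding v_def by (subst ennreal_enn2real) (auto simp: min_less_iff_disj)
      have v0: "0 \<le> v" by (simp add: v_def)
      have "ennreal v \<le> \<sigma> \<omega>" unfolding v \<rho>_def by (simp add: min_le_iff_disj)
      then have f: "\<phi> (A v \<omega>) * X v \<omega> \<le> 1" using elim(2) v0 by simp
      have A': "A' n \<omega> = A v \<omega>" and X': "X' n \<omega> = X v \<omega>"
        by (simp_all add: A'_def X'_def stopped_eq v_def)
      have "ennreal (X v \<omega>) * g (A v \<omega>) \<le> ennreal (exp (\<Phi> x))"
      proof (cases "A v \<omega> \<le> x")
        case True
        have "exp (\<Phi> (A v \<omega>)) * (\<phi> (A v \<omega>) * X v \<omega>) \<le> exp (\<Phi> x) * 1"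
          using True f P.x_nonneg[OF v0] by (intro mult_mono) (auto intro: Phi_mono simp: phi_nonneg)
        moreover have "ennreal (X v \<omega>) * g (A v \<omega>) = ennreal (exp (\<Phi> (A v \<omega>)) * (\<phi> (A v \<omega>) * X v \<omega>))"
          using True P.x_nonneg[OF v0] by (simp add: g_def ennreal_mult'[symmetric] phi_nonneg mult_ac)
        ultimately show ?thesis by (simp add: ennreal_leI)
      qed (simp add: g_def)
      moreover have "exp (\<Phi> (min (A v \<omega>) x)) \<le> exp (\<Phi> x)"
        by (simp add: Phi_mono)
      then have "exp (\<Phi> (min (A v \<omega>) x)) - 1 \<le> exp (\<Phi> x)"
        by linarith
      ultimately show "0 \<le> A' n \<omega> \<and> ennreal (X' n \<omega>) * g (A' n \<omega>) \<le> ennreal (exp (\<Phi> x)) \<and>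
          ennreal (exp (\<Phi> (min (A' n \<omega>) x)) - 1) \<le> ennreal (exp (\<Phi> x))"
        unfolding A' X' using P.a_nonneg[OF v0] by (simp add: ennreal_leI)
    qed
  qed
  have fin: "(\<integral>\<^sup>+\<omega>. ennreal (exp (\<Phi> x)) \<partial>M) < \<infinity>"
    by (simp add: emeasure_space_1)
  have eq: "(\<integral>\<^sup>+\<omega>. ennreal (X' n \<omega>) * g (A' n \<omega>) \<partial>M)
      = (\<integral>\<^sup>+\<omega>. ennreal (exp (\<Phi> (min (A' n \<omega>) x)) - 1) \<partial>M)" for n
  proof -
    have "(\<integral>\<^sup>+\<omega>. ennreal (X' n \<omega>) * g (A' n \<omega>) \<partial>M)
        = (\<integral>\<^sup>+\<omega>. (\<integral>\<^sup>+y. indicator {0..A' n \<omega>} y * g y \<partial>lborel) \<partial>M)"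
      unfolding X'_def A'_def \<rho>_def by (intro optional_stopping_nn_integral \<sigma>) auto
    also have "\<dots> = (\<integral>\<^sup>+\<omega>. ennreal (exp (\<Phi> (min (A' n \<omega>) x)) - 1) \<partial>M)"
      using bounds by (intro nn_integral_cong_AE)
        (auto elim!: eventually_mono simp: g_def weight_integral x)
    finally show ?thesis .
  qed
  have "(\<lambda>n. \<integral>\<^sup>+\<omega>. ennreal (X' n \<omega>) * g (A' n \<omega>) \<partial>M) \<longlonglongrightarrow> (\<integral>\<^sup>+\<omega>. ?L \<omega> \<partial>M)"
    by (rule nn_integral_dominated_convergence[OF _ L_meas, where w = "\<lambda>_. ennreal (exp (\<Phi> x))"])
      (use bounds lims fin in \<open>auto elim!: eventually_mono\<close>)
  moreover have "(\<lambda>n. \<integral>\<^sup>+\<omega>. ennreal (exp (\<Phi> (min (A' n \<omega>) x)) - 1) \<partial>M) \<longlonglongrightarrow> (\<integral>\<^sup>+\<omega>. ?R \<omega> \<partial>M)"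
    by (rule nn_integral_dominated_convergence[OF _ R_meas, where w = "\<lambda>_. ennreal (exp (\<Phi> x))"])
      (use bounds lims fin in \<open>auto elim!: eventually_mono\<close>)
  ultimately show ?thesis
    unfolding eq by (rule LIMSEQ_unique)
qed

section \<open>The announced time and the law of \<open>A\<close> at it\<close>

definition passage_time :: "real \<Rightarrow> 'a \<Rightarrow> ennreal" where
  "passage_time c \<omega> = first_passage \<phi> (\<lambda>t. A t \<omega>) (\<lambda>t. X t \<omega>) c"

definition announced_time :: "'a \<Rightarrow> ennreal" where
  "announced_time \<omega> = announcing_limit \<phi> (\<lambda>t. A t \<omega>) (\<lambda>t. X t \<omega>)"

lemma stopping_time_passage_time: "stopping_time F (passage_time c)"
  unfolding passage_time_def[abs_def] first_passage_def
proof (rule stopping_time_entrance)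
  fix q :: real assume "0 \<le> q"
  then have [measurable]: "A q \<in> borel_measurable (F (ennreal q))" "X q \<in> borel_measurable (F (ennreal q))"
    using A_adapted X_adapted by (simp_all add: adapted_def)
  have "{\<omega> \<in> space (F (ennreal q)). c < \<phi> (A q \<omega>) * X q \<omega>} \<in> sets (F (ennreal q))"
    by measurable
  then show "{\<omega> \<in> space M. c < \<phi> (A q \<omega>) * X q \<omega>} \<in> sets (F (ennreal q))"
    by (simp add: space_F)
qed

lemma announced_time_eq: "announced_time \<omega> = (SUP n. passage_time (level n) \<omega>)"
  by (simp add: announced_time_def passage_time_def announcing_limit_def)

lemma stopping_time_announced_time: "stopping_time F announced_time"
  unfolding announced_time_eq[abs_def] by (intro stopping_time_SUP stopping_time_passage_time)

text \<open>At the passage times the weight is exactly \<open>level n\<close>, which tends to 1, and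
  the remaining factors tend to their values at the announced time. The weight 1 thus enters as a
  limit from the left, whether or not \<open>X\<close> jumps at the announced time.\<close>

lemma exponential_identity_announced:
  assumes x: "0 \<le> x"
  shows "(\<integral>\<^sup>+\<omega>. ennreal (if announced_time \<omega> < \<infinity> \<and> value_at A announced_time \<omega> \<le> x
      then exp (\<Phi> (value_at A announced_time \<omega>)) else 0) \<partial>M)
    = (\<integral>\<^sup>+\<omega>. ennreal ((if announced_time \<omega> < \<infinity> then exp (\<Phi> (min (value_at A announced_time \<omega>) x))
      else exp (\<Phi> x)) - 1) \<partial>M)"
proof -
  define T where "T n = passage_time (level n)" for n
  have T: "stopping_time F (T n)" for n
    unfolding T_def by (rule stopping_time_passage_time)
  define W where "W \<sigma> \<omega> = (if \<sigma> \<omega> < \<infinity> \<and> value_at A \<sigma> \<omega> \<le> x then exp (\<Phi> (value_at A \<sigma> \<omega>)) else 0)"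
    for \<sigma> \<omega>
  define R where "R \<sigma> \<omega> = (if \<sigma> \<omega> < \<infinity> then exp (\<Phi> (min (value_at A \<sigma> \<omega>) x)) else exp (\<Phi> x)) - 1"
    for \<sigma> \<omega>
  have meas: "W \<sigma> \<in> borel_measurable M" "R \<sigma> \<in> borel_measurable M" if \<sigma>: "stopping_time F \<sigma>" for \<sigma>
  proof -
    note [measurable] = borel_measurable_stopping_time[OF \<sigma>]
      value_at_measurable[OF A_adapted A_right_continuous \<sigma>]
    have "W \<sigma> = (\<lambda>\<omega>. let a = (if \<sigma> \<omega> < \<infinity> then value_at A \<sigma> \<omega> else 0)
        in if \<sigma> \<omega> < \<infinity> \<and> a \<le> x then exp (\<Phi> a) else 0)"
      by (auto simp: W_def fun_eq_iff Let_def)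
    also have "\<dots> \<in> borel_measurable M" unfolding Let_def by measurable
    finally show "W \<sigma> \<in> borel_measurable M" .
    have "R \<sigma> = (\<lambda>\<omega>. let a = (if \<sigma> \<omega> < \<infinity> then value_at A \<sigma> \<omega> else 0)
        in (if \<sigma> \<omega> < \<infinity> then exp (\<Phi> (min a x)) else exp (\<Phi> x)) - 1)"
      by (auto simp: R_def fun_eq_iff Let_def)
    also have "\<dots> \<in> borel_measurable M" unfolding Let_def by measurable
    finally show "R \<sigma> \<in> borel_measurable M" .
  qed
  note [measurable] = meas[OF T] meas[OF stopping_time_announced_time]
  have at_passage: "AE \<omega> in M. \<forall>n. (\<forall>s\<ge>0. ennreal s \<le> T n \<omega> \<longrightarrow> \<phi> (A s \<omega>) * X s \<omega> \<le> level n) \<and>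
      (T n \<omega> < \<infinity> \<longrightarrow> \<phi> (value_at A (T n) \<omega>) * value_at X (T n) \<omega> = level n)"
    using paths
  proof eventually_elim
    case (elim \<omega>)
    then interpret P: weighted_sigma_path "\<lambda>t. X t \<omega>" "\<lambda>t. A t \<omega>" \<phi> .
    have eq: "\<phi> (A s \<omega>) * X s \<omega> = level n" if "0 \<le> s" "T n \<omega> = ennreal s" for n s
      using P.f_passage[OF level_pos[of n], of s] that by (simp add: T_def passage_time_def)
    show ?case
    proof (intro allI conjI impI)
      fix n and s :: real assume s: "0 \<le> s" "ennreal s \<le> T n \<omega>"
      show "\<phi> (A s \<omega>) * X s \<omega> \<le> level n"
      proof (cases "ennreal s < T n \<omega>")
        case True
        then show ?thesis
          using P.f_le_before[OF level_pos[of n] s(1)] by (simp add: T_def passage_time_def)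
      next
        case False
        then show ?thesis using eq[OF s(1), of n] s(2) by simp
      qed
    next
      fix n assume "T n \<omega> < \<infinity>"
      then show "\<phi> (value_at A (T n) \<omega>) * value_at X (T n) \<omega> = level n"
        unfolding value_at_def by (intro eq) (auto simp: ennreal_enn2real)
    qed
  qed
  have eq: "(\<integral>\<^sup>+\<omega>. ennreal (level n * W (T n) \<omega>) \<partial>M) = (\<integral>\<^sup>+\<omega>. ennreal (R (T n) \<omega>) \<partial>M)" for n
  proof -
    have "(\<integral>\<^sup>+\<omega>. ennreal (level n * W (T n) \<omega>) \<partial>M) = (\<integral>\<^sup>+\<omega>. ennreal (if T n \<omega> < \<infinity> \<and> value_at A (T n) \<omega> \<le> x
      then exp (\<Phi> (value_at A (T n) \<omega>)) * (\<phi> (value_at A (T n) \<omega>) * value_at X (T n) \<omega>) else 0) \<partial>M)"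
      using at_passage by (intro nn_integral_cong_AE) (auto elim!: eventually_mono simp: W_def mult.commute)
    also have "\<dots> = (\<integral>\<^sup>+\<omega>. ennreal (R (T n) \<omega>) \<partial>M)"
      unfolding R_def
    proof (rule exponential_identity[OF T x])
      show "AE \<omega> in M. \<forall>s\<ge>0. ennreal s \<le> T n \<omega> \<longrightarrow> \<phi> (A s \<omega>) * X s \<omega> \<le> 1"
        using at_passage
        by eventually_elim (meson level_less_1 less_imp_le order_trans)
    qed
    finally show ?thesis .
  qed
  have lims: "AE \<omega> in M. (\<lambda>n. W (T n) \<omega>) \<longlonglongrightarrow> W announced_time \<omega> \<and>
      (\<lambda>n. R (T n) \<omega>) \<longlonglongrightarrow> R announced_time \<omega>"
    using paths A_unbounded
  proof eventually_elim
    case (elim \<omega>)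
    then interpret P: weighted_sigma_path "\<lambda>t. X t \<omega>" "\<lambda>t. A t \<omega>" \<phi> by simp
    have T_le: "T n \<omega> \<le> announced_time \<omega>" for n
      unfolding announced_time_eq T_def by (rule SUP_upper) simp
    \<comment> \<open>Eventual equality is needed, since \<open>W\<close> is discontinuous in the
      value of \<open>A\<close> at the cutoff. It holds because \<open>A\<close> is constant just
      before a finite announced time.\<close>
    have "\<forall>\<^sub>F n in sequentially. W (T n) \<omega> = W announced_time \<omega> \<and> R (T n) \<omega> = R announced_time \<omega>"
    proof (cases "announced_time \<omega> < \<infinity>")
      case True
      then obtain r where r: "announced_time \<omega> = ennreal r" "0 \<le> r" by (cases "announced_time \<omega>") auto
      have "\<forall>\<^sub>F n in sequentially. value_at A (T n) \<omega> = value_at A announced_time \<omega>"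
        using P.announce_finite(1)[of r] r
        by (simp add: value_at_def T_def passage_time_def announced_time_def)
      then show ?thesis
      proof eventually_elim
        case (elim n)
        have "T n \<omega> < \<infinity>" using T_le[of n] True by (rule order_le_less_trans)
        with elim True show ?case by (simp add: W_def R_def)
      qed
    next
      case False
      then have inf: "announced_time \<omega> = \<infinity>" by (simp add: less_top[symmetric])
      obtain s0 where s0: "\<And>s. s0 \<le> s \<Longrightarrow> x < A s \<omega>"
        using elim(2) by (metis filterlim_at_top_dense eventually_at_top_linorder)
      have "(SUP n. T n \<omega>) = \<infinity>"
        using inf unfolding announced_time_eq T_def .
      then have "ennreal (max 0 s0) < (SUP n. T n \<omega>)"
        by (simp only: infinity_ennreal_def ennreal_less_top)
      then obtain n0 where n0: "ennreal (max 0 s0) < T n0 \<omega>"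
        by (auto simp: less_SUP_iff)
      show ?thesis
        using eventually_ge_at_top[of n0]
      proof eventually_elim
        case (elim n)
        then have "T n0 \<omega> \<le> T n \<omega>"
          unfolding T_def passage_time_def
          by (intro P.passage_mono monoD[OF strict_mono_mono[OF strict_mono_level]])
        with n0 have less: "ennreal (max 0 s0) < T n \<omega>" by (rule order_less_le_trans)
        \<comment> \<open>A late passage time may be finite or infinite; in both cases
          \<open>W\<close> vanishes and \<open>R\<close> has its value at an infinite time.\<close>
        have "x < value_at A (T n) \<omega>" if fin: "T n \<omega> < \<infinity>"
        proof -
          obtain r where r: "T n \<omega> = ennreal r" "0 \<le> r" using fin by (cases "T n \<omega>") auto
          with less have "max 0 s0 < r" by (metis ennreal_less_iff max.cobounded1)
          then show ?thesis using s0[of r] r by (simp add: value_at_def)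
        qed
        then show ?case by (auto simp: W_def R_def inf)
      qed
    qed
    then show ?case
      by (auto elim!: eventually_mono intro!: tendsto_eventually)
  qed
  have bounds: "W \<sigma> \<omega> \<le> exp (\<Phi> x)" "0 \<le> W \<sigma> \<omega>" "R \<sigma> \<omega> \<le> exp (\<Phi> x)" for \<sigma> \<omega>
  proof -
    show "W \<sigma> \<omega> \<le> exp (\<Phi> x)" "0 \<le> W \<sigma> \<omega>"
      by (auto simp: W_def Phi_mono)
    have "exp (\<Phi> (min (value_at A \<sigma> \<omega>) x)) \<le> exp (\<Phi> x)"
      by (simp add: Phi_mono)
    then have "exp (\<Phi> (min (value_at A \<sigma> \<omega>) x)) - 1 \<le> exp (\<Phi> x)"
      by linarith
    then show "R \<sigma> \<omega> \<le> exp (\<Phi> x)"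
      by (simp add: R_def)
  qed
  have fin: "(\<integral>\<^sup>+\<omega>. ennreal (exp (\<Phi> x)) \<partial>M) < \<infinity>"
    by (simp add: emeasure_space_1)
  have "(\<lambda>n. \<integral>\<^sup>+\<omega>. ennreal (level n * W (T n) \<omega>) \<partial>M) \<longlonglongrightarrow> (\<integral>\<^sup>+\<omega>. ennreal (W announced_time \<omega>) \<partial>M)"
  proof (rule nn_integral_dominated_convergence[where w = "\<lambda>_. ennreal (exp (\<Phi> x))"])
    have "level n * W (T n) \<omega> \<le> exp (\<Phi> x)" for n \<omega>
      using mult_mono[of "level n" 1 "W (T n) \<omega>" "exp (\<Phi> x)"] bounds level_less_1[of n] by simp
    then show "AE \<omega> in M. ennreal (level n * W (T n) \<omega>) \<le> ennreal (exp (\<Phi> x))" for n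
      by (auto intro: ennreal_leI)
    show "AE \<omega> in M. (\<lambda>n. ennreal (level n * W (T n) \<omega>)) \<longlonglongrightarrow> ennreal (W announced_time \<omega>)"
      using lims
    proof eventually_elim
      case (elim \<omega>)
      then have "(\<lambda>n. level n * W (T n) \<omega>) \<longlonglongrightarrow> 1 * W announced_time \<omega>"
        by (intro tendsto_mult level_tendsto) simp
      then show ?case by (intro tendsto_ennrealI) simp
    qed
  qed (use fin in auto)
  moreover have "(\<lambda>n. \<integral>\<^sup>+\<omega>. ennreal (R (T n) \<omega>) \<partial>M) \<longlonglongrightarrow> (\<integral>\<^sup>+\<omega>. ennreal (R announced_time \<omega>) \<partial>M)"
  proof (rule nn_integral_dominated_convergence[where w = "\<lambda>_. ennreal (exp (\<Phi> x))"])
    show "AE \<omega> in M. ennreal (R (T n) \<omega>) \<le> ennreal (exp (\<Phi> x))" for n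
      using bounds(3) by (auto intro: ennreal_leI)
    show "AE \<omega> in M. (\<lambda>n. ennreal (R (T n) \<omega>)) \<longlonglongrightarrow> ennreal (R announced_time \<omega>)"
      using lims by eventually_elim (auto intro: tendsto_ennrealI)
  qed (use fin in auto)
  ultimately have "(\<integral>\<^sup>+\<omega>. ennreal (W announced_time \<omega>) \<partial>M) = (\<integral>\<^sup>+\<omega>. ennreal (R announced_time \<omega>) \<partial>M)"
    unfolding eq by (rule LIMSEQ_unique)
  then show ?thesis by (simp add: W_def R_def)
qed

text \<open>The identity at the announced time \<open>S\<close> and the limit of the identities at the passage times
  have the same right-hand side. Comparing the left-hand sides shows that the weight
  \<open>\<phi> (A S) * X S \<le> 1\<close> is \<open>1\<close> almost surely, i.e. that \<open>X\<close> does not jump at \<open>S\<close>.\<close>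

lemma no_jump_at_announced_time:
  "AE \<omega> in M. announced_time \<omega> < \<infinity> \<longrightarrow>
    \<phi> (value_at A announced_time \<omega>) * value_at X announced_time \<omega> = 1"
proof -
  let ?S = announced_time
  let ?\<theta> = "\<lambda>\<omega>. \<phi> (value_at A ?S \<omega>) * value_at X ?S \<omega>"
  have le1: "AE \<omega> in M. \<forall>s\<ge>0. ennreal s \<le> ?S \<omega> \<longrightarrow> \<phi> (A s \<omega>) * X s \<omega> \<le> 1"
    using paths
  proof eventually_elim
    case (elim \<omega>)
    then interpret P: weighted_sigma_path "\<lambda>t. X t \<omega>" "\<lambda>t. A t \<omega>" \<phi> .
    show ?case
    proof (intro allI impI)
      fix s :: real assume s: "0 \<le> s" "ennreal s \<le> ?S \<omega>"
      show "\<phi> (A s \<omega>) * X s \<omega> \<le> 1"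
      proof (cases "ennreal s < ?S \<omega>")
        case True
        then show ?thesis
          using P.f_le_before_announce[OF s(1)] by (simp add: announced_time_def)
      next
        case False
        with s have "?S \<omega> = ennreal s" by simp
        then show ?thesis
          using P.announce_finite(2)[of s] s(1) by (simp add: announced_time_def)
      qed
    qed
  qed
  note [measurable] = borel_measurable_stopping_time[OF stopping_time_announced_time]
    value_at_measurable[OF A_adapted A_right_continuous stopping_time_announced_time]
    value_at_measurable[OF X_adapted X_right_continuous stopping_time_announced_time]
  \<comment> \<open>The cutoff at \<open>real n\<close> makes both integrals finite, so that
    \<open>V \<le> W\<close> with equal integrals forces \<open>V = W\<close> almost surely.
    Dividing by the positive exponential gives the weight 1; countably many \<open>n\<close> exhaust
    all values of \<open>A\<close>.\<close>
  have eq1: "AE \<omega> in M. ?S \<omega> < \<infinity> \<and> value_at A ?S \<omega> \<le> real n \<longrightarrow> ?\<theta> \<omega> = 1" for n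
  proof -
    define W where "W \<omega> = (if ?S \<omega> < \<infinity> \<and> value_at A ?S \<omega> \<le> real n
      then exp (\<Phi> (value_at A ?S \<omega>)) else 0)" for \<omega>
    define V where "V \<omega> = (if ?S \<omega> < \<infinity> \<and> value_at A ?S \<omega> \<le> real n
      then exp (\<Phi> (value_at A ?S \<omega>)) * ?\<theta> \<omega> else 0)" for \<omega>
    have W_eq: "W = (\<lambda>\<omega>. let a = (if ?S \<omega> < \<infinity> then value_at A ?S \<omega> else 0)
        in if ?S \<omega> < \<infinity> \<and> a \<le> real n then exp (\<Phi> a) else 0)"
      by (auto simp: W_def fun_eq_iff Let_def)
    have [measurable]: "W \<in> borel_measurable M" unfolding W_eq Let_def by measurable
    have V_eq: "V = (\<lambda>\<omega>. let a = (if ?S \<omega> < \<infinity> then value_at A ?S \<omega> else 0);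
        z = (if ?S \<omega> < \<infinity> then value_at X ?S \<omega> else 0)
        in if ?S \<omega> < \<infinity> \<and> a \<le> real n then exp (\<Phi> a) * (\<phi> a * z) else 0)"
      by (auto simp: V_def fun_eq_iff Let_def)
    have [measurable]: "V \<in> borel_measurable M" unfolding V_eq Let_def by measurable
    have eq: "(\<integral>\<^sup>+\<omega>. ennreal (V \<omega>) \<partial>M) = (\<integral>\<^sup>+\<omega>. ennreal (W \<omega>) \<partial>M)"
      unfolding V_def W_def
      using exponential_identity[OF stopping_time_announced_time _ le1, of "real n"]
        exponential_identity_announced[of "real n"] by simp
    have VW: "AE \<omega> in M. 0 \<le> V \<omega> \<and> V \<omega> \<le> W \<omega>"
      using le1 paths
    proof eventually_elim
      case (elim \<omega>)
      then interpret P: weighted_sigma_path "\<lambda>t. X t \<omega>" "\<lambda>t. A t \<omega>" \<phi> by simp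
      have "0 \<le> value_at X ?S \<omega>" by (simp add: value_at_def P.x_nonneg)
      moreover have "?\<theta> \<omega> \<le> 1" if "?S \<omega> < \<infinity>"
        using that elim(1) by (auto simp: value_at_def ennreal_enn2real)
      ultimately show ?case by (auto simp: V_def W_def phi_nonneg)
    qed
    have W0: "0 \<le> W \<omega>" and W1: "W \<omega> \<le> exp (\<Phi> (real n))" for \<omega>
      by (auto simp: W_def Phi_mono)
    have intW: "integrable M W"
      by (rule integrable_const_bound[where B = "exp (\<Phi> (real n))"]) (auto simp: W0 W1)
    have intV: "integrable M V"
    proof (rule integrable_const_bound[where B = "exp (\<Phi> (real n))"])
      show "AE \<omega> in M. norm (V \<omega>) \<le> exp (\<Phi> (real n))"
        using VW
      proof eventually_elim
        case (elim \<omega>)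
        then show ?case using W1[of \<omega>] by simp
      qed
    qed simp
    have "(\<integral>\<omega>. V \<omega> \<partial>M) = enn2real (\<integral>\<^sup>+\<omega>. ennreal (V \<omega>) \<partial>M)"
      using VW by (intro integral_eq_nn_integral) (auto elim: eventually_mono)
    also have "\<dots> = (\<integral>\<omega>. W \<omega> \<partial>M)"
      unfolding eq by (intro integral_eq_nn_integral[symmetric]) (auto simp: W0)
    finally have "(\<integral>\<omega>. W \<omega> - V \<omega> \<partial>M) = 0"
      using intW intV by simp
    then have "AE \<omega> in M. W \<omega> - V \<omega> = 0"
      by (subst (asm) integral_nonneg_eq_0_iff_AE)
        (use VW intW intV in \<open>auto elim: eventually_mono\<close>)
    then show ?thesis
      by eventually_elim (auto simp: W_def V_def)
  qed
  have "AE \<omega> in M. \<forall>n. ?S \<omega> < \<infinity> \<and> value_at A ?S \<omega> \<le> real n \<longrightarrow> ?\<theta> \<omega> = 1"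
    unfolding AE_all_countable by (intro allI eq1)
  then show ?thesis
    by eventually_elim (use real_arch_simple in blast)
qed

text \<open>All levels are passed no later than any time at which the weighted path is 1, so the
  announced time comes no later than the hitting time. If it is finite, the absence of a jump makes
  it one of the times over which the infimum runs.\<close>

lemma hitting_time_eq: "AE \<omega> in M. announced_time \<omega> = hitting_time \<phi> A X \<omega>"
  using paths no_jump_at_announced_time
proof eventually_elim
  case (elim \<omega>)
  then interpret P: weighted_sigma_path "\<lambda>t. X t \<omega>" "\<lambda>t. A t \<omega>" \<phi> by simp
  have ge: "announced_time \<omega> \<le> hitting_time \<phi> A X \<omega>"
    unfolding hitting_time_def announced_time_def
    by (intro Inf_greatest) (use P.announce_le in auto)
  show ?case
  proof (cases "announced_time \<omega> < \<infinity>")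
    case True
    then obtain r where r: "announced_time \<omega> = ennreal r" "0 \<le> r"
      by (cases "announced_time \<omega>") auto
    then have "\<phi> (A r \<omega>) * X r \<omega> = 1"
      using elim(2) by (simp add: value_at_def)
    then have "hitting_time \<phi> A X \<omega> \<le> announced_time \<omega>"
      unfolding hitting_time_def r(1) using r(2) by (intro Inf_lower) auto
    with ge show ?thesis by (rule antisym)
  next
    case False
    then show ?thesis using ge by (simp add: less_top[symmetric] top_unique)
  qed
qed

lemma prob_announced_time:
  assumes x: "0 \<le> x"
  shows "prob {\<omega> \<in> space M. announced_time \<omega> < \<infinity> \<longrightarrow> x < value_at A announced_time \<omega>} = exp (- \<Phi> x)"
proof -
  let ?S = announced_time
  note [measurable] = borel_measurable_stopping_time[OF stopping_time_announced_time]
    value_at_measurable[OF A_adapted A_right_continuous stopping_time_announced_time]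
  define a where "a \<omega> = (if ?S \<omega> < \<infinity> then value_at A ?S \<omega> else 0)" for \<omega>
  have [measurable]: "a \<in> borel_measurable M" unfolding a_def[abs_def] by measurable
  define E where "E = {\<omega> \<in> space M. ?S \<omega> < \<infinity> \<longrightarrow> x < a \<omega>}"
  have [measurable]: "E \<in> sets M" unfolding E_def by measurable
  define W where "W \<omega> = (if \<omega> \<in> E then 0 else exp (\<Phi> (a \<omega>)))" for \<omega>
  define R where "R \<omega> = (if \<omega> \<in> E then exp (\<Phi> x) else exp (\<Phi> (a \<omega>))) - 1" for \<omega>
  have a0: "AE \<omega> in M. 0 \<le> a \<omega>"
    using paths
  proof eventually_elim
    case (elim \<omega>)
    then interpret P: weighted_sigma_path "\<lambda>t. X t \<omega>" "\<lambda>t. A t \<omega>" \<phi> .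
    show ?case by (simp add: a_def value_at_def P.a_nonneg)
  qed
  have [measurable]: "W \<in> borel_measurable M" "R \<in> borel_measurable M"
    unfolding W_def[abs_def] R_def[abs_def] by measurable
  have "(\<integral>\<^sup>+\<omega>. ennreal (W \<omega>) \<partial>M) = (\<integral>\<^sup>+\<omega>. ennreal (if ?S \<omega> < \<infinity> \<and> value_at A ?S \<omega> \<le> x
      then exp (\<Phi> (value_at A ?S \<omega>)) else 0) \<partial>M)"
    by (intro nn_integral_cong) (auto simp: W_def E_def a_def)
  also have "\<dots> = (\<integral>\<^sup>+\<omega>. ennreal ((if ?S \<omega> < \<infinity> then exp (\<Phi> (min (value_at A ?S \<omega>) x))
      else exp (\<Phi> x)) - 1) \<partial>M)"
    using x by (rule exponential_identity_announced)
  also have "\<dots> = (\<integral>\<^sup>+\<omega>. ennreal (R \<omega>) \<partial>M)"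
    by (intro nn_integral_cong) (auto simp: R_def E_def a_def min_def)
  finally have eq: "(\<integral>\<^sup>+\<omega>. ennreal (W \<omega>) \<partial>M) = (\<integral>\<^sup>+\<omega>. ennreal (R \<omega>) \<partial>M)" .
  have ax: "a \<omega> \<le> x" if "\<omega> \<in> space M" "\<omega> \<notin> E" for \<omega>
    using that by (auto simp: E_def)
  have W: "AE \<omega> in M. 0 \<le> W \<omega> \<and> W \<omega> \<le> exp (\<Phi> x)"
    using AE_space by eventually_elim (auto simp: W_def Phi_mono ax)
  have R: "AE \<omega> in M. 0 \<le> R \<omega> \<and> R \<omega> \<le> exp (\<Phi> x)"
    using a0 AE_space
  proof eventually_elim
    case (elim \<omega>)
    show ?case
    proof (cases "\<omega> \<in> E")
      case True
      then show ?thesis using Phi_nonneg[OF x] by (simp add: R_def)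
    next
      case False
      have "exp (\<Phi> (a \<omega>)) \<le> exp (\<Phi> x)"
        using ax[OF elim(2) False] by (simp add: Phi_mono)
      then have "exp (\<Phi> (a \<omega>)) - 1 \<le> exp (\<Phi> x)"
        by linarith
      then show ?thesis using False Phi_nonneg[OF elim(1)] by (simp add: R_def)
    qed
  qed
  have W_abs: "AE \<omega> in M. norm (W \<omega>) \<le> exp (\<Phi> x)"
    using W by eventually_elim simp
  have R_abs: "AE \<omega> in M. norm (R \<omega>) \<le> exp (\<Phi> x)"
    using R by eventually_elim simp
  have int: "integrable M W" "integrable M R"
    by (rule integrable_const_bound[OF W_abs], measurable)
      (rule integrable_const_bound[OF R_abs], measurable)
  have "(\<integral>\<omega>. W \<omega> \<partial>M) = enn2real (\<integral>\<^sup>+\<omega>. ennreal (W \<omega>) \<partial>M)"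
    using W by (intro integral_eq_nn_integral) (auto elim: eventually_mono)
  also have "\<dots> = (\<integral>\<omega>. R \<omega> \<partial>M)"
    unfolding eq using R by (intro integral_eq_nn_integral[symmetric]) (auto elim: eventually_mono)
  finally have "0 = (\<integral>\<omega>. R \<omega> - W \<omega> \<partial>M)"
    using int by simp
  \<comment> \<open>Off \<open>E\<close> the two exponentials of \<open>a\<close> cancel and leave
    \<open>-1\<close>; on \<open>E\<close> the variable \<open>W\<close> is 0.\<close>
  also have "\<dots> = (\<integral>\<omega>. exp (\<Phi> x) * indicator E \<omega> - 1 \<partial>M)"
    by (intro Bochner_Integration.integral_cong) (auto simp: R_def W_def)
  also have "\<dots> = exp (\<Phi> x) * prob E - 1"
  proof -
    have "integrable M (\<lambda>\<omega>. exp (\<Phi> x) * indicator E \<omega> :: real)"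
      by (intro integrable_mult_right integrable_real_indicator) (auto simp: emeasure_eq_measure)
    then show ?thesis
      by (subst Bochner_Integration.integral_diff) (auto simp: prob_space)
  qed
  finally have "prob E = exp (- \<Phi> x)"
    by (simp add: exp_minus field_simps)
  moreover have "E = {\<omega> \<in> space M. ?S \<omega> < \<infinity> \<longrightarrow> x < value_at A ?S \<omega>}"
    by (auto simp: E_def a_def)
  ultimately show ?thesis by simp
qed

text \<open>An infinite announced time belongs to each of the events whose probabilities are
  \<open>exp (- \<Phi> (real n))\<close>, and these become arbitrarily small by the divergence of
  the integral.\<close>

lemma announced_time_finite:
  assumes "(\<integral>\<^sup>+z\<in>{0..}. ennreal (\<phi> z) \<partial>lborel) = \<infinity>"
  shows "AE \<omega> in M. announced_time \<omega> < \<infinity>"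
proof -
  let ?S = announced_time
  note [measurable] = borel_measurable_stopping_time[OF stopping_time_announced_time]
    value_at_measurable[OF A_adapted A_right_continuous stopping_time_announced_time]
  have E: "{\<omega> \<in> space M. ?S \<omega> < \<infinity> \<longrightarrow> x < value_at A ?S \<omega>} \<in> sets M" for x
  proof -
    have "{\<omega> \<in> space M. ?S \<omega> < \<infinity> \<longrightarrow> x < (if ?S \<omega> < \<infinity> then value_at A ?S \<omega> else 0)} \<in> sets M"
      by measurable
    then show ?thesis by (rule back_subst[where P = "\<lambda>E. E \<in> sets M"]) auto
  qed
  have le: "prob {\<omega> \<in> space M. ?S \<omega> = \<infinity>} \<le> exp (- \<Phi> (real n))" for n
    unfolding prob_announced_time[OF of_nat_0_le_iff, symmetric]
    by (intro finite_measure_mono E) auto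
  have "prob {\<omega> \<in> space M. ?S \<omega> = \<infinity>} = 0"
  proof (rule ccontr)
    assume "prob {\<omega> \<in> space M. ?S \<omega> = \<infinity>} \<noteq> 0"
    then have pos: "0 < prob {\<omega> \<in> space M. ?S \<omega> = \<infinity>}"
      by (simp add: zero_less_measure_iff)
    obtain n :: nat where "- ln (prob {\<omega> \<in> space M. ?S \<omega> = \<infinity>}) < \<Phi> (real n)"
      using Phi_unbounded[OF assms] by blast
    then have "- \<Phi> (real n) < ln (prob {\<omega> \<in> space M. ?S \<omega> = \<infinity>})" by simp
    then have "exp (- \<Phi> (real n)) < prob {\<omega> \<in> space M. ?S \<omega> = \<infinity>}"
      using pos by (metis exp_less_mono exp_ln)
    with le[of n] show False by simp
  qed
  then have "AE \<omega> in M. ?S \<omega> \<noteq> \<infinity>"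
    by (subst AE_iff_measurable[OF _ refl]) (auto simp: emeasure_eq_measure)
  then show ?thesis
    by eventually_elim (simp add: less_top[symmetric])
qed

text \<open>\<open>T\<close> is prescribed only up to a null set. This leaves room for a weight that
  was altered at negative arguments, which \<open>A\<close> avoids almost surely.\<close>

lemma hitting_time_law:
  assumes div: "(\<integral>\<^sup>+z\<in>{0..}. ennreal (\<phi> z) \<partial>lborel) = \<infinity>"
    and T: "AE \<omega> in M. hitting_time \<phi> A X \<omega> = T \<omega>"
  shows "stopping_time F T" and "AE \<omega> in M. T \<omega> < \<infinity>"
    and "0 \<le> x \<Longrightarrow> prob {\<omega> \<in> space M. x < value_at A T \<omega>} = exp (- \<Phi> x)"
proof -
  have eq: "AE \<omega> in M. announced_time \<omega> = T \<omega>"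
    using hitting_time_eq T by eventually_elim simp
  with stopping_time_announced_time show "stopping_time F T"
    by (rule stopping_time_AE_cong)
  show "AE \<omega> in M. T \<omega> < \<infinity>"
    using announced_time_finite[OF div] eq by eventually_elim simp
  assume x: "0 \<le> x"
  note [measurable] = borel_measurable_stopping_time[OF stopping_time_announced_time]
    value_at_measurable[OF A_adapted A_right_continuous stopping_time_announced_time]
  let ?E = "{\<omega> \<in> space M. announced_time \<omega> < \<infinity> \<longrightarrow> x < value_at A announced_time \<omega>}"
  let ?H = "{\<omega> \<in> space M. x < value_at A T \<omega>}"
  have "{\<omega> \<in> space M. announced_time \<omega> < \<infinity> \<longrightarrow>
      x < (if announced_time \<omega> < \<infinity> then value_at A announced_time \<omega> else 0)} \<in> sets M"
    by measurable
  then have E: "?E \<in> sets M"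
    by (rule back_subst[where P = "\<lambda>E. E \<in> sets M"]) auto
  have EH: "AE \<omega> in M. \<omega> \<in> ?E \<longleftrightarrow> \<omega> \<in> ?H"
    using announced_time_finite[OF div] eq by eventually_elim (auto simp: value_at_def)
  \<comment> \<open>The two events agree only almost everywhere, and completeness supplies the
    measurability.\<close>
  then have "?H \<in> sets M"
    using E by (rule in_sets_AE) auto
  then have "prob ?H = prob ?E"
    using E EH by (intro finite_measure_eq_AE) (auto elim: eventually_mono)
  then show "prob ?H = exp (- \<Phi> x)"
    using prob_announced_time[OF x] by simp
qed

end

section \<open>From class (\<Sigma>) to the pathwise setting\<close>

theorem corollary4p9:
  fixes M :: "'a measure" and F :: "ennreal \<Rightarrow> 'a measure"
    and X N A :: "real \<Rightarrow> 'a \<Rightarrow> real" and \<phi> :: "real \<Rightarrow> real" and T :: "'a \<Rightarrow> ennreal"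
  assumes "usual_filtered_prob_space M F"
    and "class_Sigma M F X N A"
    and "only_negative_jumps M X"
    and "AE \<omega> in M. filterlim (\<lambda>t. A t \<omega>) at_top at_top"
    and "\<phi> \<in> borel_measurable (restrict_space borel {0..})"
    and "\<forall>x\<ge>0. 0 \<le> \<phi> x"
    and "locally_bounded_on {0..} \<phi>"
    and "(\<integral>\<^sup>+x\<in>{0..}. ennreal (\<phi> x) \<partial>lborel) = \<infinity>"
    and "T = hitting_time \<phi> A X"
  shows "stopping_time F T
    \<and> (AE \<omega> in M. T \<omega> < \<infinity>)
    \<and> (\<forall>x\<ge>0. measure M {\<omega> \<in> space M. value_at A T \<omega> > x} = exp (- (LINT z:{0..x}|lborel. \<phi> z)))"
proof -
  interpret U: usual_filtered_prob_space M F by fact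
  have X_sub: "local_submartingale M F X"
    and X_nonneg: "AE \<omega> in M. \<forall>t\<ge>0. 0 \<le> X t \<omega>"
    and decomposition: "AE \<omega> in M. \<forall>t\<ge>0. X t \<omega> = N t \<omega> + A t \<omega>"
    and N_loc: "local_martingale M F N" and N_0: "AE \<omega> in M. N 0 \<omega> = 0"
    and A_adapted: "adapted F A"
    and A_path: "AE \<omega> in M. continuous_on {0..} (\<lambda>t. A t \<omega>) \<and> mono_on {0..} (\<lambda>t. A t \<omega>) \<and> A 0 \<omega> = 0"
    and carried: "AE \<omega> in M. AE t in interval_measure (\<lambda>t. A (max 0 t) \<omega>). 0 \<le> t \<longrightarrow> X t \<omega> = 0"
    using assms(2) by (simp_all add: class_Sigma_def)
  have X_adapted: "adapted F X" and X_cadlag: "AE \<omega> in M. cadlag_path (\<lambda>t. X t \<omega>)"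
    using X_sub by (simp_all add: local_submartingale_def)
  obtain \<tau> where \<tau>: "localizing M F \<tau>"
      "\<And>n. martingale M F (\<lambda>t \<omega>. stopped N (\<tau> n) t \<omega> - N 0 \<omega>)"
    using N_loc by (auto simp: local_martingale_def)
  \<comment> \<open>The given \<open>\<phi>\<close> is constrained only on the half-line. Its
    extension by 0 is Borel and nonnegative on the whole line.\<close>
  define \<psi> where "\<psi> y = (if 0 \<le> y then \<phi> y else 0)" for y
  have phi_bounded: "\<exists>K>0. \<forall>y\<in>{0..b}. \<psi> y \<le> K" for b
  proof -
    have "bounded (\<phi> ` {0..b})"
      using assms(7) by (simp add: locally_bounded_on_def)
    then obtain K where "0 < K" "\<forall>y\<in>{0..b}. \<bar>\<phi> y\<bar> \<le> K"
      by (auto simp: bounded_pos)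
    then show ?thesis by (intro exI[of _ K]) (auto simp: \<psi>_def)
  qed
  have psi_eq: "\<psi> = (\<lambda>y. indicator {0..} y *\<^sub>R \<phi> y)"
    by (auto simp: \<psi>_def fun_eq_iff indicator_def)
  have W: "weight_function \<psi>"
  proof
    show "\<psi> \<in> borel_measurable borel"
      using assms(5) unfolding psi_eq by (subst (asm) borel_measurable_restrict_space_iff) auto
  qed (use assms(6) phi_bounded in \<open>auto simp: \<psi>_def\<close>)
  have paths: "AE \<omega> in M. weighted_sigma_path (\<lambda>t. X t \<omega>) (\<lambda>t. A t \<omega>) \<psi>"
    using X_nonneg decomposition N_0 A_path carried X_cadlag assms(3)[unfolded only_negative_jumps_def]
  proof eventually_elim
    case (elim \<omega>)
    show ?case
    proof
      show "\<exists>l. ((\<lambda>t. X t \<omega>) \<longlongrightarrow> l) (at_left t) \<and> X t \<omega> \<le> l" if t: "0 < t" for t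
      proof -
        obtain l where l: "((\<lambda>t. X t \<omega>) \<longlongrightarrow> l) (at_left t)"
          using elim(6) t by (auto simp: cadlag_path_def)
        \<comment> \<open>\<open>Lim\<close> is a choice operator; it yields the true left limit
          because the path has one.\<close>
        then have "Lim (at_left t) (\<lambda>s. X s \<omega>) = l"
          by (intro tendsto_Lim trivial_limit_at_left_real)
        with elim(7) t have "X t \<omega> \<le> l" by fastforce
        with l show ?thesis by blast
      qed
    qed (use elim phi_bounded assms(6) in \<open>auto simp: cadlag_path_def \<psi>_def\<close>)
  qed
  interpret sigma_process M F \<psi> X N A \<tau>
    by (intro sigma_process.intro sigma_process_axioms.intro assms(1,4) W X_adapted A_adapted paths
        decomposition \<tau>)
  have div: "(\<integral>\<^sup>+z\<in>{0..}. ennreal (\<psi> z) \<partial>lborel) = \<infinity>"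
    unfolding assms(8)[symmetric] by (intro nn_integral_cong) (auto simp: \<psi>_def indicator_def)
  have T: "AE \<omega> in M. hitting_time \<psi> A X \<omega> = T \<omega>"
    using paths
  proof eventually_elim
    case (elim \<omega>)
    then interpret P: weighted_sigma_path "\<lambda>t. X t \<omega>" "\<lambda>t. A t \<omega>" \<psi> .
    show ?case
      unfolding assms(9) hitting_time_def
      by (intro arg_cong[where f = Inf] Collect_cong ex_cong1) (auto simp: \<psi>_def P.a_nonneg)
  qed
  have "\<Phi> x = (LINT z:{0..x}|lborel. \<phi> z)" for x
    unfolding \<Phi>_def by (intro set_lebesgue_integral_cong) (auto simp: \<psi>_def)
  then show ?thesis
    using hitting_time_law[OF div T] by auto
qed

end
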